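(* Let $I=[0,\infty[$ and let $G$ be a subgroup of $G(I;A,P)$ containing $B(I;A,P)$. If the image of $\rho\colon G\to\mathrm{Aff}(A,P)$ is not abelian, then $\sigma_r\colon G\to P$ is a non-trivial homomorphism and $\sigma_r\circ\alpha=\sigma_r$ for every automorphism $\alpha$ of $G$.
   Context: $P$ is a non-trivial subgroup of $\mathbb{R}^\times_{>0}$ and $A$ is a non-zero additive subgroup of $\mathbb{R}$ stable under multiplication by $P$. $\mathrm{PL}_o(\mathbb{R})$ is the group of orientation preserving piecewise linear homeomorphisms of $\mathbb{R}$ with finitely many break points (points where left and right derivative differ). $G(I;A,P)$ is the subgroup of all $g\in\mathrm{PL}_o(\mathbb{R})$ whose support $\{t\mid g(t)\ne t\}$ is contained in $I$, whose slopes lie in $P$, whose break points lie in $A$, and with $g(A)=A$. $B(I;A,P)$ is the subgroup of those $g\in G(I;A,P)$ that are the identity near $0$ and near $+\infty$. $\mathrm{Aff}(A,P)$ is the group of affine maps $f$ of $\mathbb{R}$ with slope in $P$ and $f(0)\in A$. For $g\in G$, $\rho(g)$ is the affine map coinciding with $g$ near $+\infty$, and $\sigma_r(g)$ is the slope of $g$ near $+\infty$. *)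

theory Defs
  imports "HOL-Analysis.Analysis" "HOL-Algebra.Coset" "HOL-Algebra.Bij"
begin

definition pos_real_group :: "real monoid" where
  "pos_real_group = \<lparr>carrier = {0<..}, mult = (*), one = 1\<rparr>"

definition add_real_group :: "real monoid" where
  "add_real_group = \<lparr>carrier = UNIV, mult = (+), one = 0\<rparr>"

definition affine_map :: "real \<Rightarrow> real \<Rightarrow> real \<Rightarrow> real" where
  "affine_map p a = (\<lambda>t. p * t + a)"

definition breaks :: "(real \<Rightarrow> real) \<Rightarrow> real set" where
  "breaks g = {t. \<exists>l r. (g has_real_derivative l) (at_left t) \<and>
                        (g has_real_derivative r) (at_right t) \<and> l \<noteq> r}"

definition slopes :: "(real \<Rightarrow> real) \<Rightarrow> real set" where
  "slopes g = {m. \<exists>t. (g has_real_derivative m) (at t)}"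

(* The last conjunct is piecewise linearity: g is affine on every interval free of break points. *)
definition PLo :: "(real \<Rightarrow> real) set" where
  "PLo = {g. (\<exists>h. homeomorphism UNIV UNIV g h) \<and> strict_mono g \<and> finite (breaks g) \<and>
             (\<forall>T. connected T \<and> T \<inter> breaks g = {} \<longrightarrow>
                  (\<exists>p a. \<forall>t\<in>T. g t = affine_map p a t))}"

definition support :: "(real \<Rightarrow> real) \<Rightarrow> real set" where
  "support g = {t. g t \<noteq> t}"

definition PLG :: "real set \<Rightarrow> real set \<Rightarrow> real set \<Rightarrow> (real \<Rightarrow> real) set" where
  "PLG I A P = {g \<in> PLo. support g \<subseteq> I \<and> slopes g \<subseteq> P \<and> breaks g \<subseteq> A \<and> g ` A = A}"

(* B(I;A,P) for the half line I = [0,\<infinity>[ only: 0 and +\<infinity> are the end points of this I. *)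
definition PLB_halfline :: "real set \<Rightarrow> real set \<Rightarrow> (real \<Rightarrow> real) set" where
  "PLB_halfline A P = {g \<in> PLG {0..} A P.
     (\<forall>\<^sub>F t in nhds 0. g t = t) \<and> (\<forall>\<^sub>F t in at_top. g t = t)}"

text \<open>All groups of maps carry composition: \<^term>\<open>BijGroup (UNIV :: real set)\<close> is the group
  of all bijections of the real line.\<close>

definition map_group :: "(real \<Rightarrow> real) set \<Rightarrow> (real \<Rightarrow> real) monoid" where
  "map_group H = (BijGroup UNIV)\<lparr>carrier := H\<rparr>"

definition Aff :: "real set \<Rightarrow> real set \<Rightarrow> (real \<Rightarrow> real) monoid" where
  "Aff A P = map_group {affine_map p a | p a. p \<in> P \<and> a \<in> A}"

definition rho :: "(real \<Rightarrow> real) \<Rightarrow> real \<Rightarrow> real" where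
  "rho g = (THE f. (\<exists>p a. f = affine_map p a) \<and> (\<forall>\<^sub>F t in at_top. g t = f t))"

definition sigma_r :: "(real \<Rightarrow> real) \<Rightarrow> real" where
  "sigma_r g = (THE p. \<exists>a. \<forall>\<^sub>F t in at_top. g t = affine_map p a t)"

end

theory Submission
  imports Defs
begin

text \<open>
  The homomorphism \<^const>\<open>sigma_r\<close> is invariant because the abstract group \<open>G\<close> remembers which of its
  elements satisfy \<open>g t > t\<close> near \<open>+\<infinity>\<close>. Granting this, let \<open>g\<close> be a commutator that is the
  translation by some \<open>\<tau> > 0\<close> near \<open>+\<infinity>\<close>; it exists because \<open>rho ` G\<close> is not abelian. For \<open>q\<close> in
  \<open>G\<close> and natural numbers \<open>m\<close>, \<open>n\<close>, the element \<open>g\<^sup>-\<^sup>m q g\<^sup>n q\<^sup>-\<^sup>1\<close> is the translation by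
  \<open>(n \<cdot> sigma_r q - m) \<cdot> \<tau>\<close> near \<open>+\<infinity>\<close>, so it moves points to the right precisely if
  \<open>n \<cdot> sigma_r q > m\<close>. An automorphism \<open>\<alpha>\<close> carries \<open>g\<close> to another commutator of this kind, hence
  \<open>sigma_r q\<close> and \<open>sigma_r (\<alpha> q)\<close> exceed the same rational numbers (lemma \<open>sigma_r_invariant\<close>).

  The order near infinity cannot be read off from the affine group \<open>rho ` G\<close> alone: the semidirect
  product of \<open>\<int>[\<surd>2]\<close> and the powers of \<open>3 + 2\<surd>2\<close> has an automorphism, given by \<open>\<surd>2 \<mapsto> -\<surd>2\<close>, that
  inverts all slopes. What is used instead is that \<open>G\<close> knows the supports of its elements well
  enough. Let \<open>W(k)\<close> consist of all elements commuting with every commutator of two elements of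
  the centralizer of \<open>k\<close>. If \<open>k\<close> is a non-trivial translation near \<open>+\<infinity>\<close> without fixed points
  beyond \<open>M\<close>, then \<open>W(k)\<close> contains every element supported beyond \<open>M\<close>
  (\<open>in_hull_of_translation\<close>); conversely elements of \<open>W(k)\<close> are the identity on every interval of
  the half line on which \<open>k\<close> is the identity (\<open>hull_fixes\<close>).

  The two ends of the half line are told apart by commutators: they are the identity near \<open>0\<close>,
  where germs are linear, and translations near \<open>+\<infinity>\<close>. If \<open>k\<close> is a commutator with non-trivial
  translation part and fixes everything up to a point far to the right, then the intersection of
  all \<open>W(g\<^sup>n k g\<^sup>-\<^sup>n)\<close> is trivial as soon as \<open>g\<close> moves points to the right near \<open>+\<infinity>\<close>: the conjugates
  escape to infinity. If \<open>g\<close> does not do so, the intersection contains all elements supported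
  far out. This is the criterion \<open>sweeps_up_iff\<close>.
\<close>

section \<open>An algebraic criterion for upward motion near infinity\<close>

definition conjugate :: "('a, 'b) monoid_scheme \<Rightarrow> 'a \<Rightarrow> 'a \<Rightarrow> 'a" where
  "conjugate H q k = q \<otimes>\<^bsub>H\<^esub> k \<otimes>\<^bsub>H\<^esub> inv\<^bsub>H\<^esub> q"

definition commutator :: "('a, 'b) monoid_scheme \<Rightarrow> 'a \<Rightarrow> 'a \<Rightarrow> 'a" where
  "commutator H u v = u \<otimes>\<^bsub>H\<^esub> v \<otimes>\<^bsub>H\<^esub> inv\<^bsub>H\<^esub> u \<otimes>\<^bsub>H\<^esub> inv\<^bsub>H\<^esub> v"

text \<open>The centralizer of the set of commutators of the centralizer of \<open>k\<close>. In the groups considered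
  below it approximates the set of elements whose support lies in the closure of the support of
  \<open>k\<close>: if \<open>k\<close> is a non-trivial translation near infinity, elements commuting with \<open>k\<close> there commute with
  each other, whereas wherever \<open>k\<close> is the identity its centralizer is as large as possible.\<close>

definition support_hull :: "('a, 'b) monoid_scheme \<Rightarrow> 'a \<Rightarrow> 'a set" where
  "support_hull H k = {f \<in> carrier H. \<forall>u\<in>carrier H. \<forall>v\<in>carrier H.
     u \<otimes>\<^bsub>H\<^esub> k = k \<otimes>\<^bsub>H\<^esub> u \<longrightarrow> v \<otimes>\<^bsub>H\<^esub> k = k \<otimes>\<^bsub>H\<^esub> v \<longrightarrow>
     f \<otimes>\<^bsub>H\<^esub> commutator H u v = commutator H u v \<otimes>\<^bsub>H\<^esub> f}"

text \<open>For a commutator \<open>k\<close> this will detect that \<open>k\<close> is not the identity near \<open>+\<infinity>\<close>: if its support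
  is bounded, some conjugate of \<open>k\<close> has support disjoint from that of \<open>k\<close>, and otherwise all
  conjugates overlap far out.\<close>

definition persistent :: "('a, 'b) monoid_scheme \<Rightarrow> 'a \<Rightarrow> bool" where
  "persistent H k \<longleftrightarrow> (\<forall>q\<in>carrier H. \<exists>f\<in>carrier H.
     f \<in> support_hull H k \<and> f \<in> support_hull H (conjugate H q k) \<and> f \<noteq> \<one>\<^bsub>H\<^esub>)"

text \<open>The conjugates of a suitable commutator by the powers of \<open>g\<close> escape to infinity. Commutators
  are taken because they are the identity near \<open>0\<close>, so that infinity is the only end to which
  supports can be pushed.\<close>

definition sweeps_up :: "('a, 'b) monoid_scheme \<Rightarrow> 'a \<Rightarrow> bool" where
  "sweeps_up H g \<longleftrightarrow> (\<exists>u\<in>carrier H. \<exists>v\<in>carrier H. persistent H (commutator H u v) \<and>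
     (\<forall>f\<in>carrier H. (\<forall>n::nat. f \<in> support_hull H (conjugate H (g [^]\<^bsub>H\<^esub> n) (commutator H u v)))
        \<longrightarrow> f = \<one>\<^bsub>H\<^esub>))"

context group_hom
begin

lemma hom_conjugate:
  "q \<in> carrier G \<Longrightarrow> k \<in> carrier G \<Longrightarrow> h (conjugate G q k) = conjugate H (h q) (h k)"
  by (simp add: conjugate_def)

lemma hom_commutator:
  "u \<in> carrier G \<Longrightarrow> v \<in> carrier G \<Longrightarrow> h (commutator G u v) = commutator H (h u) (h v)"
  by (simp add: commutator_def)

end

lemma (in group) conjugate_closed [simp]:
  "q \<in> carrier G \<Longrightarrow> k \<in> carrier G \<Longrightarrow> conjugate G q k \<in> carrier G"
  by (simp add: conjugate_def)

lemma (in group) commutator_closed [simp]: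
  "u \<in> carrier G \<Longrightarrow> v \<in> carrier G \<Longrightarrow> commutator G u v \<in> carrier G"
  by (simp add: commutator_def)

lemma (in group) commutator_conjugate:
  assumes "q \<in> carrier G" "u \<in> carrier G" "v \<in> carrier G"
  shows "commutator G (conjugate G q u) (conjugate G q v) = conjugate G q (commutator G u v)"
proof -
  have "inv q \<otimes> (q \<otimes> x) = x" if "x \<in> carrier G" for x
    using assms that by (simp flip: m_assoc)
  then show ?thesis using assms by (simp add: conjugate_def commutator_def m_assoc inv_mult_group)
qed

text \<open>This makes the criterion useful: it is expressed by the group operation alone, so that it does not
  depend on how the group acts on the line.\<close>

lemma sweeps_up_iso:
  assumes "group H" "group K" and iso: "h \<in> iso H K" and g: "g \<in> carrier H"
  shows "sweeps_up K (h g) \<longleftrightarrow> sweeps_up H g"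
proof -
  interpret group_hom H K h
    using assms by (simp add: group_hom_def group_hom_axioms_def iso_def)
  have inj: "inj_on h (carrier H)" and surj: "carrier K = h ` carrier H"
    using iso by (auto simp: iso_def bij_betw_def)
  have eq: "h x = h y \<longleftrightarrow> x = y" if "x \<in> carrier H" "y \<in> carrier H" for x y
    using inj that by (auto dest: inj_onD)
  have one: "h x = \<one>\<^bsub>K\<^esub> \<longleftrightarrow> x = \<one>\<^bsub>H\<^esub>" if "x \<in> carrier H" for x
    using eq[of x "\<one>\<^bsub>H\<^esub>"] that by simp
  have comm: "h x \<otimes>\<^bsub>K\<^esub> h y = h y \<otimes>\<^bsub>K\<^esub> h x \<longleftrightarrow> x \<otimes>\<^bsub>H\<^esub> y = y \<otimes>\<^bsub>H\<^esub> x"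
    if "x \<in> carrier H" "y \<in> carrier H" for x y
    using eq[of "x \<otimes>\<^bsub>H\<^esub> y" "y \<otimes>\<^bsub>H\<^esub> x"] that by simp
  have hull: "h f \<in> support_hull K (h k) \<longleftrightarrow> f \<in> support_hull H k"
    if "f \<in> carrier H" "k \<in> carrier H" for f k
    using that by (simp add: support_hull_def surj comm flip: hom_commutator)
  have pers: "persistent K (h k) \<longleftrightarrow> persistent H k" if "k \<in> carrier H" for k
    using that by (simp add: persistent_def surj hull one flip: hom_conjugate)
  show ?thesis
    using g by (simp add: sweeps_up_def surj pers hull one flip: hom_commutator hom_conjugate hom_nat_pow)
qed

section \<open>One-sided slopes of piecewise linear maps\<close>

text \<open>A slope in this sense is stronger than a one-sided derivative. It determines the one-sided germ
  of the map up to its value at \<open>x\<close>, and therefore passes to composites and inverses.\<close>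

definition left_slope :: "(real \<Rightarrow> real) \<Rightarrow> real \<Rightarrow> real \<Rightarrow> bool" where
  "left_slope g x p \<longleftrightarrow> p > 0 \<and> (\<forall>\<^sub>F t in at_left x. g t = g x + p * (t - x))"

definition right_slope :: "(real \<Rightarrow> real) \<Rightarrow> real \<Rightarrow> real \<Rightarrow> bool" where
  "right_slope g x p \<longleftrightarrow> p > 0 \<and> (\<forall>\<^sub>F t in at_right x. g t = g x + p * (t - x))"

lemma left_slopeI:
  assumes "b < x" "p > 0" "\<And>t. b < t \<Longrightarrow> t \<le> x \<Longrightarrow> g t = p * t + c"
  shows "left_slope g x p"
  unfolding left_slope_def eventually_at_left_field
  using assms by (auto intro!: exI[of _ b] simp: algebra_simps)

lemma right_slopeI:
  assumes "x < b" "p > 0" "\<And>t. x \<le> t \<Longrightarrow> t < b \<Longrightarrow> g t = p * t + c"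
  shows "right_slope g x p"
  unfolding right_slope_def eventually_at_right_field
  using assms by (auto intro!: exI[of _ b] simp: algebra_simps)

lemma left_slope_derivative: "left_slope g x p \<Longrightarrow> (g has_real_derivative p) (at_left x)"
  unfolding left_slope_def
  by (subst has_field_derivative_cong_eventually[where g="\<lambda>t. g x + p * (t - x)"])
     (auto intro!: derivative_eq_intros)

lemma right_slope_derivative: "right_slope g x p \<Longrightarrow> (g has_real_derivative p) (at_right x)"
  unfolding right_slope_def
  by (subst has_field_derivative_cong_eventually[where g="\<lambda>t. g x + p * (t - x)"])
     (auto intro!: derivative_eq_intros)

lemma one_sided_derivative_unique:
  fixes g :: "real \<Rightarrow> real"
  assumes "(g has_real_derivative p) (at x within S)" "(g has_real_derivative q) (at x within S)"
    and "at x within S \<noteq> bot"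
  shows "p = q"
  using assms tendsto_unique unfolding has_field_derivative_iff by blast

lemma breaks_iff_slopes:
  assumes "left_slope g x p" "right_slope g x q"
  shows "x \<in> breaks g \<longleftrightarrow> p \<noteq> q"
  using left_slope_derivative[OF assms(1)] right_slope_derivative[OF assms(2)]
    one_sided_derivative_unique[of g _ x "{..<x}"] one_sided_derivative_unique[of g _ x "{x<..}"]
  unfolding breaks_def by (auto simp: trivial_limit_at_left_real trivial_limit_at_right_real)

lemma derivative_iff_slopes:
  assumes "left_slope g x p" "right_slope g x q"
  shows "(g has_real_derivative m) (at x) \<longleftrightarrow> p = m \<and> q = m"
proof
  assume "(g has_real_derivative m) (at x)"
  then show "p = m \<and> q = m"
    using left_slope_derivative[OF assms(1)] right_slope_derivative[OF assms(2)]
      one_sided_derivative_unique[of g _ x "{..<x}"] one_sided_derivative_unique[of g _ x "{x<..}"]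
    by (metis has_field_derivative_at_within trivial_limit_at_left_real trivial_limit_at_right_real)
next
  assume "p = m \<and> q = m"
  then show "(g has_real_derivative m) (at x)"
    using left_slope_derivative[OF assms(1)] right_slope_derivative[OF assms(2)]
    by (simp add: has_field_derivative_iff filterlim_at_split)
qed

lemma isCont_of_slopes:
  assumes "left_slope g x p" "right_slope g x q"
  shows "isCont g x"
  using left_slope_derivative[OF assms(1)] right_slope_derivative[OF assms(2)]
  by (meson DERIV_continuous continuous_at_split)

lemma left_slope_inv:
  assumes "bij g" "strict_mono g" "left_slope g x p"
  shows "left_slope (inv_into UNIV g) (g x) (1 / p)"
proof -
  obtain b where b: "b < x" "\<And>t. b < t \<Longrightarrow> t < x \<Longrightarrow> g t = g x + p * (t - x)" and p: "p > 0"
    using assms(3) unfolding left_slope_def eventually_at_left_field by auto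
  show ?thesis
  proof (rule left_slopeI[of "g b"])
    show "g b < g x" using b(1) assms(2) by (simp add: strict_mono_less)
    fix s assume s: "g b < s" "s \<le> g x"
    obtain t where t: "s = g t" using assms(1) by (metis bij_pointE)
    have "b < t" "t \<le> x" using s assms(2) by (simp_all add: t strict_mono_less strict_mono_less_eq)
    then have "s = g x + p * (t - x)" using b(2)[of t] t by (cases "t = x") auto
    moreover have "(inv_into UNIV g) s = t" using t assms(1) by (simp add: bij_is_inj)
    ultimately show "(inv_into UNIV g) s = 1 / p * s + (x - g x / p)" using p by (simp add: field_simps)
  qed (use p in auto)
qed

lemma right_slope_inv:
  assumes "bij g" "strict_mono g" "right_slope g x p"
  shows "right_slope (inv_into UNIV g) (g x) (1 / p)"
proof -
  obtain b where b: "x < b" "\<And>t. x < t \<Longrightarrow> t < b \<Longrightarrow> g t = g x + p * (t - x)" and p: "p > 0"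
    using assms(3) unfolding right_slope_def eventually_at_right_field by auto
  show ?thesis
  proof (rule right_slopeI[of _ "g b"])
    show "g x < g b" using b(1) assms(2) by (simp add: strict_mono_less)
    fix s assume s: "g x \<le> s" "s < g b"
    obtain t where t: "s = g t" using assms(1) by (metis bij_pointE)
    have "x \<le> t" "t < b" using s assms(2) by (simp_all add: t strict_mono_less strict_mono_less_eq)
    then have "s = g x + p * (t - x)" using b(2)[of t] t by (cases "t = x") auto
    moreover have "(inv_into UNIV g) s = t" using t assms(1) by (simp add: bij_is_inj)
    ultimately show "(inv_into UNIV g) s = 1 / p * s + (x - g x / p)" using p by (simp add: field_simps)
  qed (use p in auto)
qed

lemma strict_mono_inv_real:
  fixes g :: "real \<Rightarrow> real"
  assumes "bij g" "strict_mono g"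
  shows "strict_mono (inv_into UNIV g)"
proof (rule strict_monoI)
  fix x y :: real assume "x < y"
  then have "g (inv_into UNIV g x) < g (inv_into UNIV g y)" using assms(1) by (simp add: bij_is_surj surj_f_inv_f)
  then show "inv_into UNIV g x < inv_into UNIV g y" using assms(2) by (simp add: strict_mono_less)
qed

text \<open>Slopes yield continuity, and they pass to the inverse by \<open>left_slope_inv\<close> and
  \<open>right_slope_inv\<close>, so that the inverse is continuous for the same reason.\<close>

lemma homeomorphism_of_slopes:
  assumes "bij g" "strict_mono g" and l: "\<And>x. left_slope g x (p x)" and r: "\<And>x. right_slope g x (q x)"
  shows "homeomorphism UNIV UNIV g (inv_into UNIV g)"
proof -
  have "isCont g x" for x using l r by (rule isCont_of_slopes)
  moreover have "isCont (inv_into UNIV g) y" for y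
    using isCont_of_slopes[OF left_slope_inv right_slope_inv, OF assms(1,2) l assms(1,2) r, of "(inv_into UNIV g) y"]
      assms(1) by (simp add: bij_is_surj surj_f_inv_f)
  ultimately show ?thesis using assms(1)
    by (auto simp: homeomorphism_def continuous_on_eq_continuous_at bij_is_inj bij_is_surj
        surj_f_inv_f bij_imp_bij_inv)
qed

lemma PLoD:
  assumes "g \<in> PLo"
  shows "bij g" "strict_mono g" "finite (breaks g)" "continuous_on UNIV g"
    "\<And>T. connected T \<Longrightarrow> T \<inter> breaks g = {} \<Longrightarrow> \<exists>p a. \<forall>t\<in>T. g t = p * t + a"
  using assms by (auto simp: PLo_def affine_map_def homeomorphism_def strict_mono_imp_inj_on
      intro!: bijI strict_mono_imp_inj_on)

text \<open>Close enough to \<open>x\<close> there are no break points other than possibly \<open>x\<close> itself, so the map is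
  affine on either side; continuity glues the two pieces at \<open>x\<close>, and monotonicity makes their
  slopes positive.\<close>

lemma PLo_slopes:
  assumes "g \<in> PLo"
  shows "\<exists>p. left_slope g x p" "\<exists>p. right_slope g x p"
proof -
  note g = PLoD[OF assms]
  obtain d where d: "d > 0" "\<And>y. y \<in> breaks g \<Longrightarrow> y \<noteq> x \<Longrightarrow> d \<le> dist x y"
    using finite_set_avoid[OF g(3)] by blast
  have cont: "isCont g x" using g(4) by (simp add: continuous_on_eq_continuous_at)
  have "{x-d<..<x} \<inter> breaks g = {}" "{x<..<x+d} \<inter> breaks g = {}"
    using d(2) by (force simp: dist_real_def)+
  then obtain p a q b where pa: "\<And>t. t \<in> {x-d<..<x} \<Longrightarrow> g t = p * t + a"
      and qb: "\<And>t. t \<in> {x<..<x+d} \<Longrightarrow> g t = q * t + b"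
    using g(5)[of "{x-d<..<x}"] g(5)[of "{x<..<x+d}"] by fastforce
  have "\<forall>\<^sub>F t in at_left x. g t = p * t + a"
    unfolding eventually_at_left_field using d(1) pa by (intro exI[of _ "x-d"]) auto
  moreover have "((\<lambda>t. p * t + a) \<longlongrightarrow> p * x + a) (at_left x)" by (intro tendsto_intros)
  ultimately have "(g \<longlongrightarrow> p * x + a) (at_left x)" by (simp add: tendsto_cong)
  moreover have "(g \<longlongrightarrow> g x) (at_left x)" "(g \<longlongrightarrow> g x) (at_right x)"
    using cont by (simp_all add: continuous_within filterlim_at_split)
  ultimately have gx: "g x = p * x + a"
    using tendsto_unique trivial_limit_at_left_real by blast
  have "\<forall>\<^sub>F t in at_right x. g t = q * t + b"
    unfolding eventually_at_right_field using d(1) qb by (intro exI[of _ "x+d"]) auto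
  moreover have "((\<lambda>t. q * t + b) \<longlongrightarrow> q * x + b) (at_right x)" by (intro tendsto_intros)
  ultimately have "(g \<longlongrightarrow> q * x + b) (at_right x)" by (simp add: tendsto_cong)
  then have gx': "g x = q * x + b"
    using \<open>(g \<longlongrightarrow> g x) (at_right x)\<close> tendsto_unique trivial_limit_at_right_real by blast
  have "g (x - d/2) < g x" "g x < g (x + d/2)" using g(2) d(1) by (auto simp: strict_mono_less)
  then have "p * (d/2) > 0" "q * (d/2) > 0"
    using d(1) pa[of "x-d/2"] qb[of "x+d/2"] gx gx' by (auto simp: algebra_simps)
  then have "p > 0" "q > 0" using d(1) by (simp_all add: zero_less_mult_iff)
  then have "left_slope g x p" "right_slope g x q"
    using d(1) pa qb gx gx'
    by (auto intro!: left_slopeI[of "x-d" x p g a] right_slopeI[of x "x+d" q g b]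
        simp: less_eq_real_def)
  then show "\<exists>p. left_slope g x p" "\<exists>p. right_slope g x p" by blast+
qed

lemma PLo_affine_at_top:
  assumes "g \<in> PLo"
  shows "\<exists>p a. p > 0 \<and> (\<forall>\<^sub>F t in at_top. g t = p * t + a) \<and>
    (\<exists>t. (g has_real_derivative p) (at t))"
proof -
  note g = PLoD[OF assms]
  obtain M where M: "\<And>t. t \<in> breaks g \<Longrightarrow> t \<le> M"
    using g(3) by (meson bdd_above_finite bdd_above.E)
  then obtain p a where pa: "\<And>t. t > M \<Longrightarrow> g t = p * t + a"
    using g(5)[of "{M<..}"] by fastforce
  have "g (M+1) < g (M+2)" using g(2) by (simp add: strict_mono_less)
  then have "p > 0" using pa[of "M+1"] pa[of "M+2"] by (simp add: algebra_simps)
  moreover have "left_slope g (M+1) p" "right_slope g (M+1) p"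
    using \<open>p > 0\<close> pa by (auto intro!: left_slopeI[of M] right_slopeI[of _ "M+2"])
  ultimately have "(g has_real_derivative p) (at (M+1))"
    by (subst derivative_iff_slopes) auto
  moreover have "\<forall>\<^sub>F t in at_top. g t = p * t + a" using pa by (auto simp: eventually_at_top_dense)
  ultimately show ?thesis using \<open>p > 0\<close> by blast
qed

text \<open>The inverse in \<^term>\<open>map_group (PLG I A P)\<close> is a definite description inside \<^term>\<open>PLG I A P\<close>; it agrees
  with the inverse map only once the latter is known to be piecewise linear of the same kind.\<close>

lemma PLo_inv:
  assumes "g \<in> PLo"
  shows "inv_into UNIV g \<in> PLo" "breaks (inv_into UNIV g) = g ` breaks g" "slopes (inv_into UNIV g) = (\<lambda>p. 1 / p) ` slopes g"
proof -
  note g = PLoD[OF assms]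
  obtain p q where pq: "\<And>x. left_slope g x (p x)" "\<And>x. right_slope g x (q x)"
    using PLo_slopes[OF assms] by metis
  have pos: "p x > 0" "q x > 0" for x using pq by (auto simp: left_slope_def right_slope_def)
  have inv: "left_slope (inv_into UNIV g) (g x) (1 / p x)" "right_slope (inv_into UNIV g) (g x) (1 / q x)" for x
    using left_slope_inv right_slope_inv g(1,2) pq by blast+
  have "g x \<in> breaks (inv_into UNIV g) \<longleftrightarrow> x \<in> breaks g" for x
    using breaks_iff_slopes[OF inv] breaks_iff_slopes[OF pq] pos[of x] by simp
  then show br: "breaks (inv_into UNIV g) = g ` breaks g"
    using g(1) by (auto simp: image_iff) (metis bij_pointE)
  have "(inv_into UNIV g has_real_derivative m) (at (g x)) \<longleftrightarrow> (\<exists>r. m = 1 / r \<and> (g has_real_derivative r) (at x))"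
    for m x
    using pos[of x] unfolding derivative_iff_slopes[OF inv] derivative_iff_slopes[OF pq]
    by (auto simp: field_simps) (metis mult_cancel_left less_irrefl mult_zero_left zero_neq_one)
  then show "slopes (inv_into UNIV g) = (\<lambda>p. 1 / p) ` slopes g"
    unfolding slopes_def image_def using g(1) by (auto; metis bij_pointE)
  have hom: "homeomorphism UNIV UNIV (inv_into UNIV g) g"
    using homeomorphism_of_slopes[OF g(1,2) pq] by (rule homeomorphism_symD)
  have "\<exists>p a. \<forall>t\<in>T. (inv_into UNIV g) t = affine_map p a t"
    if T: "connected T" "T \<inter> breaks (inv_into UNIV g) = {}" for T
  proof -
    have "connected (inv_into UNIV g ` T)"
      using hom T(1) by (meson connected_continuous_image continuous_on_subset homeomorphism_cont1 top_greatest)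
    moreover have "(inv_into UNIV g) ` T \<inter> breaks g = {}"
      using T(2) g(1) by (auto simp: br bij_is_surj surj_f_inv_f) (metis IntI bij_inv_eq_iff empty_iff image_eqI)
    ultimately obtain p a where pa: "\<And>t. t \<in> T \<Longrightarrow> t = p * (inv_into UNIV g) t + a"
      using g(5)[of "(inv_into UNIV g) ` T"] g(1) by (auto simp: bij_is_surj surj_f_inv_f)
    show ?thesis
    \<comment> \<open>The slope \<open>p\<close> vanishes only if \<open>T\<close> has at most one point.\<close>
    proof (cases "p = 0")
      case True
      then have "(inv_into UNIV g) t = affine_map 0 (inv_into UNIV g a) t" if "t \<in> T" for t
        using pa[OF that] by (simp add: affine_map_def)
      then show ?thesis by blast
    next
      case False
      then have "(inv_into UNIV g) t = affine_map (1/p) (- a/p) t" if "t \<in> T" for t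
        using pa[OF that] by (simp add: affine_map_def field_simps)
      then show ?thesis by blast
    qed
  qed
  then show "inv_into UNIV g \<in> PLo"
    unfolding PLo_def using hom strict_mono_inv_real[OF g(1,2)] g(3) by (auto simp: br)
qed

section \<open>Elements with small support\<close>

locale PL_data =
  fixes A P :: "real set"
  assumes P_subgroup: "subgroup P pos_real_group" and P_nontrivial: "P \<noteq> {1}"
    and A_subgroup: "subgroup A add_real_group" and A_nonzero: "A \<noteq> {0}"
    and smult_closed: "\<And>p a. p \<in> P \<Longrightarrow> a \<in> A \<Longrightarrow> p * a \<in> A"
begin

lemma P_pos: "p \<in> P \<Longrightarrow> p > 0"
  using subgroup.subset[OF P_subgroup] by (auto simp: pos_real_group_def)

lemma P_one: "1 \<in> P"
  using subgroup.one_closed[OF P_subgroup] by (simp add: pos_real_group_def)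

lemma P_mult: "p \<in> P \<Longrightarrow> q \<in> P \<Longrightarrow> p * q \<in> P"
  using subgroup.m_closed[OF P_subgroup] by (simp add: pos_real_group_def)

lemma P_inverse: assumes "p \<in> P" shows "1 / p \<in> P"
proof -
  have "group pos_real_group"
    by (rule groupI) (auto simp: pos_real_group_def intro!: bexI[of _ "1 / _"])
  then have "inv\<^bsub>pos_real_group\<^esub> p = 1 / p"
    using P_pos[OF assms] by (intro group.inv_equality) (auto simp: pos_real_group_def)
  then show ?thesis using subgroup.m_inv_closed[OF P_subgroup assms] by simp
qed

lemma A_zero: "0 \<in> A"
  using subgroup.one_closed[OF A_subgroup] by (simp add: add_real_group_def)

lemma A_add: "a \<in> A \<Longrightarrow> b \<in> A \<Longrightarrow> a + b \<in> A"
  using subgroup.m_closed[OF A_subgroup] by (simp add: add_real_group_def)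

lemma A_uminus: assumes "a \<in> A" shows "- a \<in> A"
proof -
  have "group add_real_group"
    by (rule groupI) (auto simp: add_real_group_def intro!: exI[of _ "- _"])
  then have "inv\<^bsub>add_real_group\<^esub> a = - a"
    by (intro group.inv_equality) (auto simp: add_real_group_def)
  then show ?thesis using subgroup.m_inv_closed[OF A_subgroup assms] by simp
qed

lemma A_diff: "a \<in> A \<Longrightarrow> b \<in> A \<Longrightarrow> a - b \<in> A"
  using A_add[of a "- b"] A_uminus[of b] by simp

lemma small_slope:
  assumes "e > 0" obtains p where "p \<in> P" "p < 1" "p < e"
proof -
  obtain q where "q \<in> P" "q \<noteq> 1" using P_nontrivial P_one by blast
  define r where "r = (if q < 1 then q else 1 / q)"
  have r: "r \<in> P" "r < 1" "r > 0"
    using \<open>q \<in> P\<close> \<open>q \<noteq> 1\<close> P_inverse P_pos[OF \<open>q \<in> P\<close>] by (auto simp: r_def)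
  obtain n where n: "r ^ n < min e 1"
    using real_arch_pow_inv[of "min e 1" r] r assms by auto
  have "r ^ k \<in> P" for k by (induction k) (auto simp: P_one P_mult r)
  then show thesis using that n by (meson min_less_iff_conj)
qed

text \<open>A non-trivial group of slopes contains arbitrarily small ones; applied to a fixed element of
  \<open>A\<close> they give arbitrarily small elements of \<open>A\<close>.\<close>

lemma small_positive:
  assumes "e > 0" obtains a where "a \<in> A" "0 < a" "a < e"
proof -
  obtain b where "b \<in> A" "b \<noteq> 0" using A_nonzero A_zero by blast
  then obtain b where b: "b \<in> A" "b > 0" using A_uminus[of b] by (metis linorder_neqE neg_0_less_iff_less)
  obtain p where p: "p \<in> P" "p < e / b" using small_slope[of "e / b"] b assms by auto
  have "p * b < e" using p(2) b(2) by (simp add: pos_less_divide_eq)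
  then show thesis using that smult_closed[OF p(1) b(1)] P_pos[OF p(1)] b(2) by simp
qed

text \<open>
  Multiples of one small positive element of \<open>A\<close> already meet every interval of given length.\<close>

lemma A_dense:
  assumes "x < y" obtains a where "a \<in> A" "x < a" "a < y"
proof -
  obtain d where d: "d \<in> A" "0 < d" "d < y - x" using small_positive[of "y - x"] assms by auto
  have nat: "real n * d \<in> A" for n
    by (induction n) (auto simp: A_zero A_add d algebra_simps)
  have int: "of_int k * d \<in> A" for k :: int
  proof (cases "k \<ge> 0")
    case True then show ?thesis using nat[of "nat k"] by simp
  next
    case False then show ?thesis using A_uminus[OF nat[of "nat (- k)"]] by simp
  qed
  define k where "k = \<lfloor>x / d\<rfloor> + 1"
  have "x / d < of_int k" "of_int k \<le> x / d + 1" unfolding k_def by linarith+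
  then have "x < of_int k * d" "of_int k * d \<le> x + d"
    using d(2) by (auto simp: field_simps)
  then show thesis using that[OF int[of k]] d(3) by simp
qed

end

text \<open>The map that contracts \<open>[a, a + l]\<close> by the factor \<open>p < 1\<close> towards \<open>a\<close> and compensates this by
  expanding the next interval, of length \<open>p * l\<close>, by \<open>1 / p\<close>. The two lengths are chosen so that
  the end point \<open>a + l + p * l\<close> is fixed again.\<close>

definition bump :: "real \<Rightarrow> real \<Rightarrow> real \<Rightarrow> real \<Rightarrow> real" where
  "bump a l p t = (if t \<le> a then t else if t \<le> a + l then a + p * (t - a)
     else if t \<le> a + l + p * l then a + p * l + (t - (a + l)) / p else t)"

lemma connected_avoiding:
  fixes T :: "real set"
  assumes "connected T" "c \<notin> T"
  shows "T \<subseteq> {..<c} \<or> T \<subseteq> {c<..}"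
proof (rule ccontr)
  assume "\<not> ?thesis"
  then obtain x y where "x \<in> T" "y \<in> T" "c \<le> x" "y \<le> c" by (auto simp: subset_iff not_less)
  then show False using connectedD_interval[OF assms(1), of y x c] assms(2) by blast
qed

context
  fixes a l p :: real
  assumes l: "l > 0" and p: "0 < p" "p < 1"
begin

lemma bump_ends: "a < a + l" "a + l < a + l + p * l" "a + p * l < a + l"
  using l p by auto

lemma bump_fixes: "t \<le> a \<or> a + l + p * l \<le> t \<Longrightarrow> bump a l p t = t"
proof (cases "t = a + l + p * l")
  case True
  then show ?thesis using l p bump_ends by (simp add: bump_def)
next
  case False
  assume "t \<le> a \<or> a + l + p * l \<le> t"
  then have "t \<le> a \<or> (\<not> t \<le> a \<and> \<not> t \<le> a + l \<and> \<not> t \<le> a + l + p * l)" using False bump_ends by linarith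
  then show ?thesis by (auto simp: bump_def)
qed

lemma bump_less:
  assumes "a < t" "t < a + l + p * l" shows "bump a l p t < t"
proof (cases "t \<le> a + l")
  case True
  have "p * (t - a) < 1 * (t - a)" using assms p by (intro mult_strict_right_mono) auto
  then have "a + p * (t - a) < t" by simp
  then show ?thesis using assms True by (simp add: bump_def)
next
  case False
  have "(1 - p) * (t - (a + l)) < (1 - p) * (p * l)" using assms p by (intro mult_strict_left_mono) auto
  then show ?thesis using assms p False by (simp add: bump_def field_simps)
qed

lemma bump_strict_mono: "strict_mono (bump a l p)"
proof (rule strict_monoI)
  fix s t :: real assume st: "s < t"
  let ?f = "bump a l p"
  have 1: "?f s < ?f t" if "s < t" "t \<le> a" for s t
    using that by (simp add: bump_def)
  have 2: "?f s < ?f t" if "s < t" "a \<le> s" "t \<le> a + l" for s t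
    using that p by (auto simp: bump_def intro: mult_pos_pos)
  have 3: "?f s < ?f t" if "s < t" "a + l \<le> s" "t \<le> a + l + p * l" for s t
    using that p l by (auto simp: bump_def field_simps)
  have 4: "?f s < ?f t" if "s < t" "a + l + p * l \<le> s" for s t
    using that bump_fixes[of s] bump_fixes[of t] by simp
  have 34: "?f s < ?f t" if "s < t" "a + l \<le> s" for s t
    using that 3[of s t] 4[of s t] 3[of s "a + l + p * l"] 4[of "a + l + p * l" t] by linarith
  have 234: "?f s < ?f t" if "s < t" "a \<le> s" for s t
    using that 2[of s t] 34[of s t] 2[of s "a + l"] 34[of "a + l" t] by linarith
  show "?f s < ?f t"
    using st 1[of s t] 234[of s t] 1[of s a] 234[of a t] by linarith
qed

lemma bump_surj: "\<exists>s. bump a l p s = t"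
proof -
  consider "t \<le> a \<or> a + l + p * l \<le> t" | "a < t" "t \<le> a + p * l" | "a + p * l < t" "t < a + l + p * l"
    by linarith
  then show ?thesis
  proof cases
    case 1 then show ?thesis using bump_fixes by blast
  next
    case 2
    then have "a < a + (t - a) / p" "a + (t - a) / p \<le> a + l" using p by (auto simp: field_simps)
    then have "bump a l p (a + (t - a) / p) = t" using p by (simp add: bump_def)
    then show ?thesis by blast
  next
    case 3
    have "p * (t - (a + p * l)) \<le> p * l" using 3 p by (intro mult_left_mono) auto
    moreover have "0 < p * (t - (a + p * l))" using 3 p by simp
    ultimately have "bump a l p (a + l + p * (t - (a + p * l))) = t"
      using p l by (simp add: bump_def not_le add_pos_pos)
    then show ?thesis by blast
  qed
qed

lemma bump_bij: "bij (bump a l p)"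
  using bump_strict_mono bump_surj by (metis bijI strict_mono_imp_inj_on surjI)

lemma bump_steep:
  assumes "a + l \<le> t" "t \<le> a + l + p * l"
  shows "bump a l p t = 1 / p * t + (a + p * l - (a + l) / p)"
proof (cases "t = a + l")
  case True
  then show ?thesis using l by (simp add: bump_def)
next
  case False
  then have "\<not> t \<le> a" "\<not> t \<le> a + l" using assms l by linarith+
  then show ?thesis using assms by (simp add: bump_def diff_divide_distrib)
qed

lemma bump_left_slope:
  "left_slope (bump a l p) t (if t \<le> a then 1 else if t \<le> a + l then p else if t \<le> a + l + p * l then 1 / p else 1)"
proof -
  consider "t \<le> a" | "a < t" "t \<le> a + l" | "a + l < t" "t \<le> a + l + p * l" | "a + l + p * l < t"
    by linarith
  then show ?thesis
  proof cases
    case 1 then show ?thesis by (auto intro!: left_slopeI[of "t - 1" t 1 _ 0] simp: bump_def)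
  next
    case 2 then show ?thesis using p
      by (auto intro!: left_slopeI[of a t p _ "a - p * a"] simp: bump_def algebra_simps)
  next
    case 3 then show ?thesis using p l
      by (auto intro!: left_slopeI[of "a + l" t "1/p"] bump_steep)
  next
    case 4
    moreover have "a < t" "a + l < t" using 4 bump_ends by linarith+
    ultimately show ?thesis using bump_fixes
      by (auto intro!: left_slopeI[of "a + l + p * l" t 1 _ 0])
  qed
qed

lemma bump_right_slope:
  "right_slope (bump a l p) t (if t < a then 1 else if t < a + l then p else if t < a + l + p * l then 1 / p else 1)"
proof -
  consider "t < a" | "a \<le> t" "t < a + l" | "a + l \<le> t" "t < a + l + p * l" | "a + l + p * l \<le> t"
    by linarith
  then show ?thesis
  proof cases
    case 1 then show ?thesis by (auto intro!: right_slopeI[of t a 1 _ 0] simp: bump_def)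
  next
    case 2 then show ?thesis using p
      by (auto intro!: right_slopeI[of t "a + l" p _ "a - p * a"] simp: bump_def algebra_simps le_less)
  next
    case 3 then show ?thesis using p l
      by (auto intro!: right_slopeI[of t "a + l + p * l" "1/p"] bump_steep)
  next
    case 4
    moreover have "\<not> t < a" "\<not> t < a + l" using 4 bump_ends by linarith+
    ultimately show ?thesis using bump_fixes
      by (auto intro!: right_slopeI[of t "t + 1" 1 _ 0])
  qed
qed

lemma bump_breaks: "breaks (bump a l p) = {a, a + l, a + l + p * l}"
proof (rule Set.set_eqI)
  fix t
  have "1 < 1 / p" using p by simp
  then have "p \<noteq> 1 / p" "p \<noteq> 1" "1 / p \<noteq> 1" using p by linarith+
  then show "t \<in> breaks (bump a l p) \<longleftrightarrow> t \<in> {a, a + l, a + l + p * l}"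
    using breaks_iff_slopes[OF bump_left_slope[of t] bump_right_slope[of t]] bump_ends
    by (simp del: divide_eq_1_iff eq_divide_eq_1)
qed

lemma bump_slopes: "slopes (bump a l p) \<subseteq> {1, p, 1 / p}"
  using derivative_iff_slopes[OF bump_left_slope bump_right_slope]
  by (auto simp: slopes_def split: if_splits)

lemma bump_PLo: "bump a l p \<in> PLo"
proof -
  have "\<exists>m b. \<forall>t\<in>T. bump a l p t = affine_map m b t"
    if T: "connected T" "T \<inter> breaks (bump a l p) = {}" for T
  proof -
    have "a \<notin> T" "a + l \<notin> T" "a + l + p * l \<notin> T" using T(2) by (auto simp: bump_breaks)
    then consider "T \<subseteq> {..<a}" | "T \<subseteq> {a<..}" "T \<subseteq> {..<a + l}"
      | "T \<subseteq> {a + l<..}" "T \<subseteq> {..<a + l + p * l}" | "T \<subseteq> {a + l + p * l<..}"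
      using connected_avoiding[OF T(1), of a] connected_avoiding[OF T(1), of "a + l"]
        connected_avoiding[OF T(1), of "a + l + p * l"] by argo
    then show ?thesis
    proof cases
      case 1 then show ?thesis
        by (intro exI[of _ 1] exI[of _ 0]) (auto simp: affine_map_def bump_fixes)
    next
      case 2 then show ?thesis
        by (intro exI[of _ p] exI[of _ "a - p * a"]) (auto simp: affine_map_def bump_def algebra_simps)
    next
      case 3
      have "bump a l p t = affine_map (1 / p) (a + p * l - (a + l) / p) t" if "t \<in> T" for t
      proof -
        have "a + l < t" "t < a + l + p * l" using 3 that by auto
        then show ?thesis by (simp add: affine_map_def bump_steep)
      qed
      then show ?thesis by blast
    next
      case 4 then show ?thesis
        by (intro exI[of _ 1] exI[of _ 0]) (auto simp: affine_map_def bump_fixes)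
    qed
  qed
  then show ?thesis
    unfolding PLo_def
    using homeomorphism_of_slopes[OF bump_bij bump_strict_mono bump_left_slope bump_right_slope]
      bump_strict_mono by (auto simp: bump_breaks)
qed

end

context PL_data
begin

lemma A_cancel: "q \<in> P \<Longrightarrow> q * t \<in> A \<longleftrightarrow> t \<in> A"
  using smult_closed[of q t] smult_closed[of "1 / q" "q * t"] P_inverse[of q] P_pos[of q] by auto

lemma A_translate: "b \<in> A \<Longrightarrow> b + t \<in> A \<longleftrightarrow> t \<in> A"
  using A_add[of b t] A_diff[of "b + t" b] by auto

text \<open>
  On each of its pieces a bump is composed of translations by elements of \<open>A\<close> and of a
  multiplication by an element of \<open>P\<close>, all of which permute \<open>A\<close>.\<close>

lemma bump_mem:
  assumes "a \<in> A" "a > 0" "l \<in> A" "l > 0" "p \<in> P" "p < 1"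
  shows "bump a l p \<in> PLB_halfline A P"
proof -
  have p: "0 < p" using P_pos assms by blast
  have pl: "p * l \<in> A" using smult_closed assms by blast
  have inv: "1 / p \<in> P" using P_inverse assms by blast
  have A_iff: "bump a l p t \<in> A \<longleftrightarrow> t \<in> A" for t
  proof -
    have "(1 / p) * (- (a + l) + t) \<in> A \<longleftrightarrow> t \<in> A"
      using A_cancel[OF inv] A_translate[OF A_uminus[OF A_add[OF assms(1,3)]]] by metis
    moreover have "(1 / p) * (- (a + l) + t) = (t - (a + l)) / p" by simp
    ultimately have "(a + p * l) + (t - (a + l)) / p \<in> A \<longleftrightarrow> t \<in> A"
      using A_translate[OF A_add[OF assms(1) pl]] by metis
    moreover have "a + p * (- a + t) \<in> A \<longleftrightarrow> t \<in> A"
      using A_cancel[OF assms(5)] A_translate[OF assms(1)] A_translate[OF A_uminus[OF assms(1)]] by metis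
    ultimately show ?thesis by (simp add: bump_def)
  qed
  have "bump a l p ` A = A"
  proof
    show "bump a l p ` A \<subseteq> A" using A_iff by blast
    show "A \<subseteq> bump a l p ` A"
    proof
      fix t assume "t \<in> A"
      moreover obtain s where "bump a l p s = t" using bump_surj[OF assms(4) p assms(6)] by blast
      ultimately show "t \<in> bump a l p ` A" using A_iff[of s] by blast
    qed
  qed
  moreover have "support (bump a l p) \<subseteq> {0..}"
  proof
    fix t assume "t \<in> support (bump a l p)"
    then have "\<not> t \<le> a" by (auto simp: support_def bump_def)
    then show "t \<in> {0..}" using assms(2) by simp
  qed
  moreover have "breaks (bump a l p) \<subseteq> A"
    unfolding bump_breaks[OF assms(4) p assms(6)]
    using assms(1) A_add[OF assms(1,3)] A_add[OF A_add[OF assms(1,3)] pl] by simp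
  moreover have "slopes (bump a l p) \<subseteq> P"
    using bump_slopes[OF assms(4) p assms(6)] assms(5) inv P_one by blast
  moreover have "\<forall>\<^sub>F t in nhds 0. bump a l p t = t"
    using eventually_nhds_in_open[of "{..<a}" 0] assms(2)
    by (auto elim!: eventually_mono simp: bump_fixes[OF assms(4) p assms(6)])
  moreover have "\<forall>\<^sub>F t in at_top. bump a l p t = t"
    using eventually_ge_at_top[of "a + l + p * l"]
    by (rule eventually_mono) (use bump_fixes[OF assms(4) p assms(6)] in blast)
  ultimately show ?thesis
    using bump_PLo[OF assms(4) p assms(6)] by (simp add: PLB_halfline_def PLG_def)
qed

lemma PLG_inv:
  assumes "g \<in> PLG I A P" shows "inv_into UNIV g \<in> PLG I A P"
proof -
  have g: "g \<in> PLo" "support g \<subseteq> I" "slopes g \<subseteq> P" "breaks g \<subseteq> A" "g ` A = A"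
    using assms by (auto simp: PLG_def)
  note bij = PLoD(1)[OF g(1)]
  have "inv_into UNIV g ` A = A"
    using g(5) bij by (metis bij_betw_def image_inv_f_f)
  moreover have "support (inv_into UNIV g) = support g"
    using bij by (auto simp: support_def) (metis bij_inv_eq_iff)+
  ultimately show ?thesis
    using PLo_inv[OF g(1)] g P_inverse image_mono[OF g(4), of g] by (auto simp: PLG_def)
qed

end

section \<open>Germs at the two ends of the half line\<close>

text \<open>The positive slope is part of the notion, so that germs at infinity can be composed and inverted.\<close>

definition affine_at_top :: "(real \<Rightarrow> real) \<Rightarrow> real \<Rightarrow> real \<Rightarrow> bool" where
  "affine_at_top g p a \<longleftrightarrow> p > 0 \<and> (\<forall>\<^sub>F t in at_top. g t = p * t + a)"

lemma eventually_affine_unique: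
  assumes "affine_at_top g p a" "\<forall>\<^sub>F t in at_top. g t = q * t + b"
  shows "q = p" "b = a"
proof -
  have "\<forall>\<^sub>F t in at_top. p * t + a = q * t + b"
    using assms unfolding affine_at_top_def by (auto elim: eventually_elim2)
  then obtain M where "\<And>t. t \<ge> M \<Longrightarrow> p * t + a = q * t + b" by (auto simp: eventually_at_top_linorder)
  from this[of M] this[of "M + 1"] have "p * M + a = q * M + b" "p * M + p + a = q * M + q + b"
    by (simp_all add: distrib_left)
  then show "q = p" by linarith
  then show "b = a" using \<open>p * M + a = q * M + b\<close> by simp
qed

lemma affine_at_top_unique:
  assumes "affine_at_top g p a" "affine_at_top g q b"
  shows "p = q" "a = b"
  using eventually_affine_unique[OF assms(2)] assms(1) by (auto simp: affine_at_top_def)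

lemma affine_at_top_comp:
  assumes "affine_at_top g p a" "affine_at_top h q b"
  shows "affine_at_top (g \<circ> h) (p * q) (p * b + a)"
proof -
  obtain M N where M: "\<And>t. t \<ge> M \<Longrightarrow> g t = p * t + a" and N: "\<And>t. t \<ge> N \<Longrightarrow> h t = q * t + b"
    using assms by (auto simp: affine_at_top_def eventually_at_top_linorder)
  have "q > 0" "p > 0" using assms by (auto simp: affine_at_top_def)
  have "(g \<circ> h) t = (p * q) * t + (p * b + a)" if "t \<ge> max N ((M - b) / q)" for t
  proof -
    have "h t \<ge> M" using that \<open>q > 0\<close> by (simp add: N field_simps)
    then show ?thesis using that by (simp add: M N algebra_simps)
  qed
  then show ?thesis using \<open>q > 0\<close> \<open>p > 0\<close>
    unfolding affine_at_top_def eventually_at_top_linorder by (meson mult_pos_pos)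
qed

lemma affine_at_top_inv:
  assumes "affine_at_top g p a" "inj g"
  shows "affine_at_top (inv_into UNIV g) (1 / p) (- a / p)"
proof -
  obtain M where M: "\<And>t. t \<ge> M \<Longrightarrow> g t = p * t + a"
    using assms by (auto simp: affine_at_top_def eventually_at_top_linorder)
  have p: "p > 0" using assms by (auto simp: affine_at_top_def)
  have "(inv_into UNIV g) s = 1 / p * s + (- a / p)" if "s \<ge> p * M + a" for s
  proof -
    have "g ((s - a) / p) = s" using that p by (subst M) (simp_all add: field_simps)
    then have "(inv_into UNIV g) s = (s - a) / p" using assms(2) by (metis inv_f_f)
    then show ?thesis by (simp add: diff_divide_distrib)
  qed
  then show ?thesis using p by (auto simp: affine_at_top_def eventually_at_top_linorder)
qed

lemma sigma_r_eq: assumes "affine_at_top g p a" shows "sigma_r g = p"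
  unfolding sigma_r_def affine_map_def
  using assms eventually_affine_unique[OF assms] by (intro the_equality) (auto simp: affine_at_top_def)

lemma rho_eq: assumes "affine_at_top g p a" shows "rho g = affine_map p a"
  unfolding rho_def
  using assms eventually_affine_unique[OF assms]
  by (intro the_equality) (auto simp: affine_at_top_def affine_map_def)

lemma right_slope_comp:
  assumes g: "right_slope g 0 p" "g 0 = 0" and h: "right_slope h 0 q" "h 0 = 0"
  shows "right_slope (g \<circ> h) 0 (p * q)"
proof -
  obtain c d where c: "c > 0" "\<And>t. 0 < t \<Longrightarrow> t < c \<Longrightarrow> g t = p * t"
      and d: "d > 0" "\<And>t. 0 < t \<Longrightarrow> t < d \<Longrightarrow> h t = q * t"
    using g h by (auto simp: right_slope_def eventually_at_right_field)
  have pq: "p > 0" "q > 0" using g h by (auto simp: right_slope_def)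
  show ?thesis
  proof (rule right_slopeI[of _ "min d (c / q)" _ _ 0])
    fix t assume t: "0 \<le> t" "t < min d (c / q)"
    show "(g \<circ> h) t = (p * q) * t + 0"
    proof (cases "t = 0")
      case False
      then have "0 < q * t" "q * t < c" using t pq by (auto simp: field_simps)
      then show ?thesis using t False by (simp add: c d)
    qed (simp add: g h)
  qed (use c d pq in auto)
qed

lemma commute_of_disjoint_supports:
  assumes "inj f" "inj g" "\<And>x. f x = x \<or> g x = x"
  shows "f \<circ> g = g \<circ> f"
proof
  fix x
  show "(f \<circ> g) x = (g \<circ> f) x"
    using assms(3)[of x] assms(3)[of "f x"] assms(3)[of "g x"] assms(1,2) by (auto simp: inj_eq)
qed

text \<open>A bounded orbit would converge to a fixed point beyond \<open>M\<close>.\<close>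

lemma iterates_unbounded:
  fixes g :: "real \<Rightarrow> real"
  assumes "continuous_on UNIV g" and up: "\<And>t. t > M \<Longrightarrow> g t > t" and "x > M"
  shows "\<exists>n. (g ^^ n) x > N"
proof (rule ccontr)
  assume "\<not> ?thesis"
  then have bdd: "(g ^^ n) x \<le> N" for n by (meson not_less)
  have above: "(g ^^ n) x > M" for n
  proof (induction n)
    case (Suc n)
    then show ?case using up[OF Suc] by simp
  qed (use assms in simp)
  have inc: "incseq (\<lambda>n. (g ^^ n) x)"
    by (rule incseq_SucI) (use up above in \<open>simp add: less_imp_le\<close>)
  obtain L where L: "(\<lambda>n. (g ^^ n) x) \<longlonglongrightarrow> L" "\<And>n. (g ^^ n) x \<le> L"
    using incseq_convergent[OF inc] bdd by blast
  have "(\<lambda>n. g ((g ^^ n) x)) \<longlonglongrightarrow> g L"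
    by (rule continuous_on_tendsto_compose[OF assms(1) L(1)]) auto
  moreover have "(\<lambda>n. g ((g ^^ n) x)) \<longlonglongrightarrow> L" using LIMSEQ_Suc[OF L(1)] by simp
  ultimately have "g L = L" by (rule LIMSEQ_unique)
  moreover have "L > M" using L(2)[of 0] assms(3) by simp
  ultimately show False using up by force
qed

locale PL_halfline_group = PL_data +
  fixes G :: "(real \<Rightarrow> real) set"
  assumes G_subgroup: "subgroup G (map_group (PLG {0..} A P))"
    and B_subset: "PLB_halfline A P \<subseteq> G"
begin

lemma G_PLG: "g \<in> G \<Longrightarrow> g \<in> PLG {0..} A P"
  using subgroup.subset[OF G_subgroup] by (auto simp: map_group_def)

lemma G_PLo: "g \<in> G \<Longrightarrow> g \<in> PLo"
  using G_PLG by (auto simp: PLG_def)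

lemmas G_bij = PLoD(1)[OF G_PLo] and G_mono = PLoD(2)[OF G_PLo] and G_cont = PLoD(4)[OF G_PLo]

lemma G_inj: "g \<in> G \<Longrightarrow> inj g"
  using G_bij by (rule bij_is_inj)

lemma G_inv_right [simp]: "g \<in> G \<Longrightarrow> g (inv_into UNIV g t) = t"
  using G_bij by (simp add: bij_is_surj surj_f_inv_f)

lemma G_inv_left [simp]: "g \<in> G \<Longrightarrow> inv_into UNIV g (g t) = t"
  using G_inj by simp

lemma BijGroup_mult: "f \<in> PLo \<Longrightarrow> g \<in> PLo \<Longrightarrow> f \<otimes>\<^bsub>BijGroup UNIV\<^esub> g = f \<circ> g"
  using PLoD(1) by (auto simp: BijGroup_def Bij_def compose_def)

lemma BijGroup_one: "\<one>\<^bsub>BijGroup UNIV\<^esub> = id"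
  by (auto simp: BijGroup_def)

lemma G_id: "id \<in> G"
  using subgroup.one_closed[OF G_subgroup] by (simp add: map_group_def BijGroup_one)

lemma G_comp: "f \<in> G \<Longrightarrow> g \<in> G \<Longrightarrow> f \<circ> g \<in> G"
  using subgroup.m_closed[OF G_subgroup, of f g] BijGroup_mult[of f g] G_PLo by (simp add: map_group_def)

lemma G_inv: assumes "g \<in> G" shows "inv_into UNIV g \<in> G"
proof -
  let ?g' = "inv_into UNIV g"
  have g': "?g' \<in> PLG {0..} A P" using PLG_inv G_PLG assms by blast
  have comp: "?g' \<circ> g = id" "g \<circ> ?g' = id" using assms by auto
  have "inv\<^bsub>map_group (PLG {0..} A P)\<^esub> g = ?g'"
    unfolding m_inv_def
  proof (rule the_equality)
    show "?g' \<in> carrier (map_group (PLG {0..} A P)) \<and>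
        g \<otimes>\<^bsub>map_group (PLG {0..} A P)\<^esub> ?g' = \<one>\<^bsub>map_group (PLG {0..} A P)\<^esub> \<and>
        ?g' \<otimes>\<^bsub>map_group (PLG {0..} A P)\<^esub> g = \<one>\<^bsub>map_group (PLG {0..} A P)\<^esub>"
      using g' G_PLo[OF assms] comp
      by (simp add: map_group_def BijGroup_mult BijGroup_one PLG_def)
  next
    fix y assume y: "y \<in> carrier (map_group (PLG {0..} A P)) \<and>
        g \<otimes>\<^bsub>map_group (PLG {0..} A P)\<^esub> y = \<one>\<^bsub>map_group (PLG {0..} A P)\<^esub> \<and>
        y \<otimes>\<^bsub>map_group (PLG {0..} A P)\<^esub> g = \<one>\<^bsub>map_group (PLG {0..} A P)\<^esub>"
    then have "g \<circ> y = id"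
      using G_PLo[OF assms] by (auto simp: map_group_def BijGroup_mult BijGroup_one PLG_def)
    then show "y = ?g'" using comp by (metis comp_assoc comp_id id_comp)
  qed
  then show ?thesis using subgroup.m_inv_closed[OF G_subgroup assms] by simp
qed

lemma subgroup_BijGroup: "subgroup G (BijGroup UNIV)"
proof (rule subgroup.intro)
  show "G \<subseteq> carrier (BijGroup UNIV)" using G_bij by (auto simp: BijGroup_def Bij_def)
  show "x \<otimes>\<^bsub>BijGroup UNIV\<^esub> y \<in> G" if "x \<in> G" "y \<in> G" for x y
    using that G_comp G_PLo by (simp add: BijGroup_mult)
  show "\<one>\<^bsub>BijGroup UNIV\<^esub> \<in> G" by (simp add: BijGroup_one G_id)
  show "inv\<^bsub>BijGroup UNIV\<^esub> x \<in> G" if "x \<in> G" for x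
    using that G_bij[OF that] G_inv by (simp add: inv_BijGroup Bij_def restrict_def)
qed

abbreviation H :: "(real \<Rightarrow> real) monoid" where "H \<equiv> map_group G"

sublocale H: group H
  unfolding map_group_def
  using group.subgroup_imp_group[OF group_BijGroup subgroup_BijGroup] .

lemma carrier_H [simp]: "carrier H = G"
  by (simp add: map_group_def)

lemma mult_H [simp]: "f \<in> G \<Longrightarrow> g \<in> G \<Longrightarrow> f \<otimes>\<^bsub>H\<^esub> g = f \<circ> g"
  using BijGroup_mult[of f g] G_PLo by (simp add: map_group_def)

lemma one_H [simp]: "\<one>\<^bsub>H\<^esub> = id"
  by (simp add: map_group_def BijGroup_one)

lemma inv_H [simp]: "g \<in> G \<Longrightarrow> inv\<^bsub>H\<^esub> g = inv_into UNIV g"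
  by (rule H.inv_equality) (auto simp: G_inv)

lemma G_funpow: "g \<in> G \<Longrightarrow> g ^^ n \<in> G"
  by (induction n) (auto simp: G_id G_comp)

lemma pow_H [simp]: "g \<in> G \<Longrightarrow> g [^]\<^bsub>H\<^esub> (n::nat) = g ^^ n"
  by (induction n) (auto simp: G_funpow funpow_Suc_right simp del: funpow.simps(2))

lemma conjugate_H:
  "q \<in> G \<Longrightarrow> k \<in> G \<Longrightarrow> conjugate H q k = q \<circ> k \<circ> inv_into UNIV q"
  by (simp add: conjugate_def G_comp G_inv)

lemma commutator_H:
  "u \<in> G \<Longrightarrow> v \<in> G \<Longrightarrow> commutator H u v = u \<circ> v \<circ> inv_into UNIV u \<circ> inv_into UNIV v"
  by (simp add: commutator_def G_comp G_inv)

lemma conjugate_G: "q \<in> G \<Longrightarrow> k \<in> G \<Longrightarrow> conjugate H q k \<in> G"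
  using H.conjugate_closed by simp

lemma commutator_G: "u \<in> G \<Longrightarrow> v \<in> G \<Longrightarrow> commutator H u v \<in> G"
  using H.commutator_closed by simp

lemma support_hull_G: "f \<in> support_hull H k \<Longrightarrow> f \<in> G"
  by (simp add: support_hull_def)

text \<open>Only the point \<open>0\<close> needs an argument, since the support lies in the closed half line: \<open>g 0\<close>
  cannot be positive, as its half would have no preimage, and it cannot be negative, as it would
  be a fixed point with two preimages.\<close>

lemma fixes_nonpos: assumes "g \<in> G" "t \<le> 0" shows "g t = t"
proof -
  have neg: "g s = s" if "s < 0" for s
    using G_PLG[OF assms(1)] that by (fastforce simp: PLG_def support_def)
  have "g 0 = 0"
  proof (rule ccontr)
    assume "g 0 \<noteq> 0"
    define s where "s = inv_into UNIV g (g 0 / 2)"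
    have s: "g s = g 0 / 2" using assms by (simp add: s_def)
    show False
    proof (cases "g 0 > 0")
      case True
      then have "s < 0" using s G_mono[OF assms(1)] by (metis field_sum_of_halves less_add_same_cancel1 half_gt_zero strict_mono_less)
      then show False using neg[of s] s True by simp
    next
      case False
      then have "g (g 0) = g 0" using neg \<open>g 0 \<noteq> 0\<close> by simp
      then show False using G_inj[OF assms(1)] \<open>g 0 \<noteq> 0\<close> by (simp add: inj_eq)
    qed
  qed
  then show ?thesis using neg assms(2) by (cases "t = 0") auto
qed

lemma ex_affine_at_top: assumes "g \<in> G" obtains p a where "p \<in> P" "affine_at_top g p a"
  using PLo_affine_at_top[OF G_PLo[OF assms]] G_PLG[OF assms]
  by (auto simp: affine_at_top_def PLG_def slopes_def subset_iff)

lemma affine_at_top_inv_G: "g \<in> G \<Longrightarrow> affine_at_top g p a \<Longrightarrow> affine_at_top (inv_into UNIV g) (1 / p) (- a / p)"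
  using affine_at_top_inv G_inj by blast

lemma ex_right_slope: "g \<in> G \<Longrightarrow> \<exists>p. right_slope g 0 p"
  using PLo_slopes G_PLo by blast

lemma right_slope_inv_0: "g \<in> G \<Longrightarrow> right_slope g 0 p \<Longrightarrow> right_slope (inv_into UNIV g) 0 (1 / p)"
  using right_slope_inv[of g 0 p] G_bij G_mono fixes_nonpos[of g 0] by simp

lemma commutator_affine_at_top:
  assumes "u \<in> G" "v \<in> G"
  shows "\<exists>\<tau>. affine_at_top (commutator H u v) 1 \<tau>"
proof -
  obtain p a q b where u: "affine_at_top u p a" and v: "affine_at_top v q b"
    using ex_affine_at_top assms by metis
  have "p > 0" "q > 0" using u v by (auto simp: affine_at_top_def)
  then have "p * q * (1 / p) * (1 / q) = 1" by simp
  then show ?thesis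
    using affine_at_top_comp[OF affine_at_top_comp[OF affine_at_top_comp[OF u v]
        affine_at_top_inv_G[OF assms(1) u]] affine_at_top_inv_G[OF assms(2) v]] commutator_H[OF assms]
    by metis
qed

text \<open>
  Near \<open>0\<close> on the right all elements are linear, and linear germs commute.\<close>

lemma commutator_fixes_near_zero:
  assumes "u \<in> G" "v \<in> G"
  obtains d where "d > 0" "\<And>t. t \<le> d \<Longrightarrow> commutator H u v t = t"
proof -
  let ?k = "commutator H u v"
  obtain p q where u: "right_slope u 0 p" and v: "right_slope v 0 q"
    using ex_right_slope assms by metis
  have "p > 0" "q > 0" using u v by (auto simp: right_slope_def)
  then have 1: "p * q * (1 / p) * (1 / q) = 1" by simp
  have "right_slope ?k 0 (p * q * (1 / p) * (1 / q))"
    unfolding commutator_H[OF assms]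
    using u v assms by (intro right_slope_comp right_slope_inv_0)
      (auto simp: fixes_nonpos G_inv)
  then obtain c where c: "c > 0" "\<And>t. 0 < t \<Longrightarrow> t < c \<Longrightarrow> ?k t = t"
    unfolding 1 using fixes_nonpos[OF commutator_G[OF assms], of 0]
    by (auto simp: right_slope_def eventually_at_right_field)
  show thesis
  proof (rule that[of "c / 2"])
    fix t assume "t \<le> c / 2"
    then show "?k t = t" using c fixes_nonpos[OF commutator_G[OF assms], of t] by (cases "t \<le> 0") auto
  qed (use c in simp)
qed

lemma conjugate_affine_at_top:
  assumes "q \<in> G" "k \<in> G" "affine_at_top q p a" "affine_at_top k 1 \<tau>"
  shows "affine_at_top (conjugate H q k) 1 (p * \<tau>)"
proof -
  have p: "p > 0" using assms by (simp add: affine_at_top_def)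
  show ?thesis
    using affine_at_top_comp[OF affine_at_top_comp[OF assms(3,4)] affine_at_top_inv_G[OF assms(1,3)]] p
    unfolding conjugate_H[OF assms(1,2)] by simp
qed

end

section \<open>Recovering supports from centralizers\<close>

context PL_halfline_group
begin

lemma small_bump:
  assumes "0 \<le> c" "c < d"
  obtains f a e where "f \<in> G" "c < a" "a \<in> A" "a < e" "e \<in> A" "e < d"
    "\<And>t. t \<le> a \<or> e \<le> t \<Longrightarrow> f t = t" "\<And>t. a < t \<Longrightarrow> t < e \<Longrightarrow> f t < t"
proof -
  obtain p where p: "p \<in> P" "p < 1" using small_slope[of 1] by auto
  obtain a where a: "a \<in> A" "c < a" "a < d" using A_dense assms by blast
  obtain l where l: "l \<in> A" "0 < l" "l < (d - a) / 2" using small_positive[of "(d - a) / 2"] a by auto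
  have p0: "p > 0" using P_pos p by blast
  have "p * l < l" using l(2) p(2) by simp
  moreover have "l + l < d - a" using l(3) by simp
  ultimately have "a + l + p * l < d" by linarith
  moreover have "a + l + p * l \<in> A" using A_add smult_closed a l p by blast
  moreover have "a < a + l + p * l" using l p0 by (simp add: add_pos_pos)
  moreover have "bump a l p \<in> G" using bump_mem[of a l p] B_subset a l p assms by auto
  ultimately show thesis
    using that[of "bump a l p" a "a + l + p * l"] a bump_fixes[OF l(2) p0 p(2)] bump_less[OF l(2) p0 p(2)]
    by blast
qed

lemma ex_nontrivial_beyond:
  obtains f where "f \<in> G" "f \<noteq> id" "\<And>t. t \<le> M \<Longrightarrow> f t = t"
proof -
  have M: "0 \<le> max M 0" "max M 0 < max M 0 + 1" by simp_all
  obtain f a e where f: "f \<in> G" "max M 0 < a" "a < e" "\<And>t. t \<le> a \<or> e \<le> t \<Longrightarrow> f t = t"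
      "\<And>t. a < t \<Longrightarrow> t < e \<Longrightarrow> f t < t"
    using small_bump[OF M] by metis
  have "f ((a + e) / 2) \<noteq> (a + e) / 2" using f(3) f(5)[of "(a + e) / 2"] by simp
  then have "f \<noteq> id" by auto
  then show thesis using that f(1,2,4) by simp
qed

text \<open>The breaks of a bump lie in \<open>A\<close>, so its middle break \<open>e\<close> has to be in \<open>A\<close> as well.\<close>

lemma bump_across:
  assumes "0 \<le> c" "c < e" "e < d" "e \<in> A"
  obtains f a b where "f \<in> G" "c < a" "a < e" "e < b" "b < d"
    "\<And>t. t \<le> a \<or> b \<le> t \<Longrightarrow> f t = t" "\<And>t. a < t \<Longrightarrow> t < b \<Longrightarrow> f t < t"
proof -
  obtain p where p: "p \<in> P" "p < 1" using small_slope[of 1] by auto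
  obtain l where l: "l \<in> A" "0 < l" "l < min (e - c) (d - e)" using small_positive[of "min (e - c) (d - e)"] assms by auto
  have p0: "p > 0" using P_pos p by blast
  have "p * l < l" "0 < p * l" using l(2) p(2) p0 by simp_all
  then have "e + p * l < d" "e < e + p * l" using l by linarith+
  moreover have "c < e - l" "e - l < e" "0 < e - l" using l assms by linarith+
  moreover have "bump (e - l) l p \<in> G" using bump_mem[of "e - l" l p] B_subset A_diff assms l p calculation by auto
  moreover have "bump (e - l) l p t = t" if "t \<le> e - l \<or> e + p * l \<le> t" for t
    using bump_fixes[OF l(2) p0 p(2), of t "e - l"] that by simp
  moreover have "bump (e - l) l p t < t" if "e - l < t" "t < e + p * l" for t
    using bump_less[OF l(2) p0 p(2), of "e - l" t] that by simp
  ultimately show thesis using that by blast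
qed

text \<open>If two maps commute, each preserves the support of the other. It is therefore enough to
  take bumps whose supports overlap without being nested.\<close>

lemma noncommuting_pair:
  assumes "0 \<le> c" "c < d"
  obtains u v t where "u \<in> G" "v \<in> G" "\<And>x. x \<le> c \<or> d \<le> x \<Longrightarrow> u x = x" "\<And>x. x \<le> c \<or> d \<le> x \<Longrightarrow> v x = x"
    "commutator H u v t \<noteq> t"
proof -
  obtain u a e where u: "u \<in> G" "c < a" "a < e" "e \<in> A" "e < d"
      "\<And>t. t \<le> a \<or> e \<le> t \<Longrightarrow> u t = t" "\<And>t. a < t \<Longrightarrow> t < e \<Longrightarrow> u t < t"
    using small_bump[OF assms] by metis
  obtain v a' b where v: "v \<in> G" "a < a'" "a' < e" "e < b" "b < d"
      "\<And>t. t \<le> a' \<or> b \<le> t \<Longrightarrow> v t = t" "\<And>t. a' < t \<Longrightarrow> t < b \<Longrightarrow> v t < t"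
    using bump_across[of a e d] u(2-5) assms(1) by auto
  \<comment> \<open>\<open>e\<close> is an end point of the support of \<open>u\<close>, and \<open>v\<close> moves it into that support.\<close>
  have "v e < e" using v by blast
  moreover have "v a' < v e" using G_mono[OF v(1)] v(3) by (simp add: strict_mono_less)
  ultimately have "u (v e) < v e" using u(7) v(2) v(6)[of a'] by simp
  moreover have "u e = e" using u(6) by blast
  ultimately have ne: "u (v e) \<noteq> v (u e)" by simp
  have "commutator H u v (v (u e)) = u (v e)"
    using u(1) v(1) by (simp add: commutator_H)
  then show thesis using that[of u v "v (u e)"] u v ne by force
qed

text \<open>The inverse of a bump expands near its left end by \<open>1 / p\<close>, and \<open>p\<close> may be taken as small as
  desired.\<close>

lemma push_right:
  assumes "0 < x" obtains q where "q \<in> G" "y < q x"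
proof -
  define M where "M = max y x"
  obtain a where a: "a \<in> A" "0 < a" "a < x" using A_dense[of 0 x] assms by auto
  have M: "M > 0" using assms by (simp add: M_def)
  obtain p where p: "p \<in> P" "p < 1" "p < (x - a) / M" using small_slope[of "(x - a) / M"] a M by auto
  have p0: "p > 0" using P_pos p by blast
  have "M < (x - a) / p" using p p0 M by (simp add: field_simps)
  obtain l where l: "l \<in> A" "(x - a) / p < l" using A_dense[of "(x - a) / p" "(x - a) / p + 1"] by auto
  have "0 < (x - a) / p" using a p0 by simp
  then have l0: "0 < l" using l by linarith
  have b: "bump a l p \<in> G" using bump_mem[of a l p] B_subset a l p l0 by auto
  have "bump a l p (a + (x - a) / p) = x" using l(2) \<open>0 < (x - a) / p\<close> p0 by (simp add: bump_def)
  then have "inv_into UNIV (bump a l p) x = a + (x - a) / p" using b by (metis G_inv_left)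
  moreover have "y < a + (x - a) / p" using \<open>M < (x - a) / p\<close> a(2) by (simp add: M_def)
  ultimately show thesis using that[OF G_inv[OF b]] by simp
qed

lemma fixes_commutator:
  assumes "u \<in> G" "v \<in> G" "u x = x" "v x = x"
  shows "commutator H u v x = x"
  using assms commutator_H[OF assms(1,2)] by (simp add: inv_f_eq[OF G_inj])

lemma conjugate_fixes_iff:
  assumes "q \<in> G" "k \<in> G"
  shows "conjugate H q k x = x \<longleftrightarrow> k (inv_into UNIV q x) = inv_into UNIV q x"
  using assms unfolding conjugate_H[OF assms] comp_def by (metis G_inv_left G_inv_right)

lemma no_fixed_point_sign:
  assumes "k \<in> G" "\<And>t. t > M \<Longrightarrow> k t \<noteq> t"
  shows "(\<forall>t>M. k t > t) \<or> (\<forall>t>M. k t < t)"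
proof (rule ccontr)
  assume "\<not> ?thesis"
  then obtain s t where st: "s > M" "k s - s \<le> 0" "t > M" "k t - t \<ge> 0" by (auto simp: not_less)
  have "connected ((\<lambda>t. k t - t) ` {M<..})"
    by (intro connected_continuous_image continuous_intros continuous_on_subset[OF G_cont[OF assms(1)]])
       (auto intro: connected_Ioi)
  then have "0 \<in> (\<lambda>t. k t - t) ` {M<..}"
    by (rule connectedD_interval[of _ "k s - s" "k t - t"]) (use st in auto)
  then show False using assms(2) by force
qed

text \<open>The powers of \<open>k\<close> or of its inverse carry \<open>t\<close> into the region near infinity where \<open>c\<close> is the
  identity, and \<open>c\<close> commutes with them.\<close>

lemma trivial_germ_propagates:
  assumes c: "c \<in> G" "\<forall>\<^sub>F t in at_top. c t = t" and k: "k \<in> G" "c \<circ> k = k \<circ> c"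
    and moves: "\<And>t. t > M \<Longrightarrow> k t \<noteq> t" and t: "t > M"
  shows "c t = t"
proof -
  have up: "c t = t" if h: "h \<in> G" "c \<circ> h = h \<circ> c" "\<And>t. t > M \<Longrightarrow> h t > t" for h
  proof -
    obtain N where N: "\<And>s. s \<ge> N \<Longrightarrow> c s = s" using c(2) by (auto simp: eventually_at_top_linorder)
    obtain n where n: "(h ^^ n) t > N" using iterates_unbounded[OF G_cont[OF h(1)] h(3) t] by blast
    have "c (h s) = h (c s)" for s using h(2) by (metis comp_apply)
    then have "c ((h ^^ n) s) = (h ^^ n) (c s)" for s by (induction n) auto
    then have "(h ^^ n) (c t) = (h ^^ n) t" using N n by (metis less_imp_le)
    then show ?thesis using G_inj[OF G_funpow[OF h(1)]] by (simp add: inj_eq)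
  qed
  consider "\<forall>t>M. k t > t" | "\<forall>t>M. k t < t" using no_fixed_point_sign[OF k(1) moves] by blast
  then show ?thesis
  proof cases
    case 1 then show ?thesis using up k by blast
  next
    case 2
    have "inv_into UNIV k s > s" if "s > M" for s
    proof -
      have "k s < k (inv_into UNIV k s)" using 2 that k(1) by simp
      then show ?thesis using G_mono[OF k(1)] by (simp add: strict_mono_less)
    qed
    moreover have "c \<circ> inv_into UNIV k = inv_into UNIV k \<circ> c"
    proof
      fix s
      have "k (c (inv_into UNIV k s)) = c s" using fun_cong[OF k(2), of "inv_into UNIV k s"] k(1) by simp
      then show "(c \<circ> inv_into UNIV k) s = (inv_into UNIV k \<circ> c) s" using k(1) by (metis G_inv_left comp_apply)
    qed
    ultimately show ?thesis using up[OF G_inv[OF k(1)]] by blast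
  qed
qed

lemma centralizes_translation:
  assumes "u \<in> G" "u \<circ> k = k \<circ> u" "affine_at_top k 1 \<tau>" "\<tau> \<noteq> 0"
  obtains a where "affine_at_top u 1 a"
proof -
  obtain p a where u: "affine_at_top u p a" using ex_affine_at_top[OF assms(1)] by blast
  have "p * \<tau> + a = 1 * a + \<tau>"
    using affine_at_top_unique(2)[OF affine_at_top_comp[OF u assms(3)]]
      affine_at_top_comp[OF assms(3) u] assms(2) by metis
  then show thesis using that u assms(4) by simp
qed

text \<open>An element commuting with \<open>k\<close> is itself a translation near infinity, because its slope there
  must fix the translation length \<open>\<tau>\<close>. Translations commute, so a commutator of two such elements
  is the identity near infinity, and, as it commutes with \<open>k\<close>, even on all of \<open>{M<..}\<close>. Its
  support is thus disjoint from that of \<open>f\<close>.\<close>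

lemma in_hull_of_translation:
  assumes k: "k \<in> G" "affine_at_top k 1 \<tau>" "\<tau> \<noteq> 0" "\<And>t. t > M \<Longrightarrow> k t \<noteq> t"
    and f: "f \<in> G" "\<And>t. t \<le> M \<Longrightarrow> f t = t"
  shows "f \<in> support_hull H k"
proof -
  have "f \<circ> commutator H u v = commutator H u v \<circ> f"
    if u: "u \<in> G" "u \<circ> k = k \<circ> u" and v: "v \<in> G" "v \<circ> k = k \<circ> v" for u v
  proof -
    let ?c = "commutator H u v"
    have c: "?c \<in> G" using commutator_G u v by blast
    obtain a b where ab: "affine_at_top u 1 a" "affine_at_top v 1 b"
      using centralizes_translation[OF _ _ k(2,3)] u v by metis
    have "affine_at_top ?c 1 0"
      using affine_at_top_comp[OF affine_at_top_comp[OF affine_at_top_comp[OF ab]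
        affine_at_top_inv_G[OF u(1) ab(1)]] affine_at_top_inv_G[OF v(1) ab(2)]]
      by (simp add: commutator_H u v)
    then have "\<forall>\<^sub>F t in at_top. ?c t = t" by (simp add: affine_at_top_def)
    moreover have "?c \<circ> k = k \<circ> ?c"
    proof -
      have inv: "inv_into UNIV w (k x) = k (inv_into UNIV w x)" if "w \<in> G" "w \<circ> k = k \<circ> w" for w x
        using fun_cong[OF that(2), of "inv_into UNIV w x"] that(1) by (metis G_inv_left G_inv_right comp_apply)
      show ?thesis
        using u v inv fun_cong[OF u(2)] fun_cong[OF v(2)] by (simp add: commutator_H fun_eq_iff)
    qed
    ultimately have "?c t = t" if "t > M" for t
      using trivial_germ_propagates c k(1,4) that by blast
    then show ?thesis
      using commute_of_disjoint_supports[of f ?c] G_inj c f by (meson not_le)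
  qed
  then show ?thesis using k(1) f(1) by (simp add: support_hull_def commutator_G)
qed

text \<open>If \<open>f\<close> moved \<open>y\<close>, it would move a whole interval around \<open>y\<close> off itself. Two non-commuting
  elements supported in that interval commute with \<open>k\<close>, so \<open>f\<close> commutes with their commutator
  \<open>w\<close>, whose support is then invariant under \<open>f\<close>; but \<open>f\<close> maps it to a disjoint set.\<close>

lemma hull_fixes:
  assumes k: "k \<in> G" "\<And>t. c < t \<Longrightarrow> t < d \<Longrightarrow> k t = t" and f: "f \<in> support_hull H k"
    and y: "0 \<le> c" "c < y" "y < d"
  shows "f y = y"
proof (rule ccontr)
  assume ne: "f y \<noteq> y"
  have fG: "f \<in> G" using f support_hull_G by blast
  have cont: "isCont f y" using G_cont[OF fG] by (simp add: continuous_on_eq_continuous_at)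
  \<comment> \<open>With this radius the intervals around \<open>y\<close> and \<open>f y\<close> are disjoint.\<close>
  define e where "e = \<bar>f y - y\<bar> / 2"
  have e: "e > 0" using ne by (simp add: e_def)
  obtain r where r: "r > 0" "\<And>x. \<bar>x - y\<bar> < r \<Longrightarrow> \<bar>f x - f y\<bar> < e"
    using cont e unfolding continuous_at_eps_delta by (auto simp: dist_real_def)
  define s where "s = min (min r e) (min (y - c) (d - y))"
  have s: "s > 0" "s \<le> r" "s \<le> e" "c \<le> y - s" "y + s \<le> d" using r e y by (auto simp: s_def)
  have ys: "0 \<le> y - s" "y - s < y + s" using s y(1) by linarith+
  obtain u v t where uv: "u \<in> G" "v \<in> G" "\<And>x. x \<le> y - s \<or> y + s \<le> x \<Longrightarrow> u x = x"
      "\<And>x. x \<le> y - s \<or> y + s \<le> x \<Longrightarrow> v x = x" and t: "commutator H u v t \<noteq> t"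
    using noncommuting_pair[OF ys] by metis
  let ?w = "commutator H u v"
  have kd: "k x = x" if "y - s < x" "x < y + s" for x using k(2) that s by simp
  have commute: "w \<circ> k = k \<circ> w" if "w \<in> G" "\<And>x. x \<le> y - s \<or> y + s \<le> x \<Longrightarrow> w x = x" for w
    using commute_of_disjoint_supports[OF G_inj[OF that(1)] G_inj[OF k(1)]] that(2) kd by (meson not_le)
  have "u \<circ> k = k \<circ> u" "v \<circ> k = k \<circ> v"
    using commute[OF uv(1,3)] commute[OF uv(2,4)] by blast+
  then have comm: "f \<circ> ?w = ?w \<circ> f" using f fG uv(1,2) k(1) by (simp add: support_hull_def commutator_G)
  have wfix: "?w x = x" if "x \<le> y - s \<or> y + s \<le> x" for x
    using fixes_commutator uv that by blast
  have "\<not> (t \<le> y - s \<or> y + s \<le> t)" using wfix t by blast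
  then have "y - s < t" "t < y + s" by simp_all
  then have "\<bar>f t - f y\<bar> < e" using r(2) s(2) by auto
  moreover have "\<bar>f y - y\<bar> = 2 * e" by (simp add: e_def)
  ultimately have "f t \<le> y - s \<or> y + s \<le> f t" using s(3) by arith
  then have "f (?w t) = f t" using fun_cong[OF comm, of t] wfix by simp
  then show False using t G_inj[OF fG] by (simp add: inj_eq)
qed

text \<open>If \<open>\<tau> = 0\<close>, the commutator is supported in some \<open>[d, N]\<close> with \<open>d > 0\<close>, and a conjugate by an
  element pushing \<open>d\<close> beyond \<open>N\<close> is the identity up to a point beyond \<open>N\<close>; then an element of
  both hulls is trivial by \<open>hull_fixes\<close>. If \<open>\<tau> \<noteq> 0\<close>, all conjugates are non-trivial translations
  near infinity, and both hulls contain everything supported far out.\<close>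

lemma persistent_commutator_iff:
  assumes u: "u \<in> G" and v: "v \<in> G" and tau: "affine_at_top (commutator H u v) 1 \<tau>"
  shows "persistent H (commutator H u v) \<longleftrightarrow> \<tau> \<noteq> 0"
proof
  let ?k = "commutator H u v"
  have k: "?k \<in> G" using commutator_G u v by blast
  assume pers: "persistent H ?k"
  show "\<tau> \<noteq> 0"
  proof
    assume "\<tau> = 0"
    then obtain N where N: "\<And>t. t \<ge> N \<Longrightarrow> ?k t = t"
      using tau by (auto simp: affine_at_top_def eventually_at_top_linorder)
    obtain d where d: "d > 0" "\<And>t. t \<le> d \<Longrightarrow> ?k t = t" using commutator_fixes_near_zero[OF u v] by metis
    obtain q where q: "q \<in> G" "q d > max N 0" using push_right[OF d(1)] by blast
    obtain f where f: "f \<in> G" "f \<in> support_hull H ?k"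
        "f \<in> support_hull H (conjugate H q ?k)" "f \<noteq> id"
      using pers q(1) unfolding persistent_def by auto
    have "f t = t" for t
    proof -
      consider "t \<le> 0" | "0 < t" "t < q d" | "max N 0 < t" using q(2) by linarith
      then show ?thesis
      proof cases
        case 1 then show ?thesis using fixes_nonpos f(1) by blast
      next
        case 2
        have "conjugate H q ?k s = s" if "s < q d" for s
        proof -
          have "q (inv_into UNIV q s) < q d" using that q(1) by simp
          then have "inv_into UNIV q s \<le> d" using G_mono[OF q(1)] by (simp add: strict_mono_less)
          then show ?thesis using conjugate_fixes_iff[OF q(1) k] d(2) by blast
        qed
        then show ?thesis using hull_fixes[OF conjugate_G[OF q(1) k] _ f(3), of 0 "q d"] 2 by simp
      next
        case 3
        then show ?thesis using hull_fixes[OF k _ f(2), of "max N 0" "t + 1" t] N by simp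
      qed
    qed
    then show False using f(4) by (auto simp: fun_eq_iff)
  qed
next
  let ?k = "commutator H u v"
  have k: "?k \<in> G" using commutator_G u v by blast
  assume "\<tau> \<noteq> 0"
  have moves: "\<exists>N. \<forall>t>N. h t \<noteq> t" if "affine_at_top h 1 \<sigma>" "\<sigma> \<noteq> 0" for h \<sigma>
  proof -
    have "\<exists>N. \<forall>t>N. h t = t + \<sigma>"
      using that(1) by (auto simp: affine_at_top_def eventually_at_top_dense)
    then show ?thesis using that(2) by force
  qed
  show "persistent H ?k"
    unfolding persistent_def carrier_H
  proof
    fix q assume q: "q \<in> G"
    let ?k' = "conjugate H q ?k"
    obtain p a where pa: "affine_at_top q p a" using ex_affine_at_top[OF q] by blast
    have k': "?k' \<in> G" "affine_at_top ?k' 1 (p * \<tau>)" "p * \<tau> \<noteq> 0"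
      using conjugate_G[OF q k] conjugate_affine_at_top[OF q k pa tau] pa \<open>\<tau> \<noteq> 0\<close>
      by (auto simp: affine_at_top_def)
    obtain N where "\<forall>t>N. ?k t \<noteq> t" using moves[OF tau \<open>\<tau> \<noteq> 0\<close>] by blast
    moreover obtain N' where "\<forall>t>N'. ?k' t \<noteq> t" using moves[OF k'(2,3)] by blast
    ultimately have N: "\<And>t. t > max N N' \<Longrightarrow> ?k t \<noteq> t" "\<And>t. t > max N N' \<Longrightarrow> ?k' t \<noteq> t" by simp_all
    obtain f where f: "f \<in> G" "f \<noteq> id" and fM: "\<And>t. t \<le> max N N' \<Longrightarrow> f t = t"
      using ex_nontrivial_beyond[of "max N N'"] by metis
    have "f \<in> support_hull H ?k"
      by (rule in_hull_of_translation[OF k tau \<open>\<tau> \<noteq> 0\<close> N(1) f(1) fM])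
    moreover have "f \<in> support_hull H ?k'"
      by (rule in_hull_of_translation[OF k' N(2) f(1) fM])
    ultimately show "\<exists>f\<in>G. f \<in> support_hull H ?k \<and> f \<in> support_hull H ?k' \<and> f \<noteq> \<one>\<^bsub>H\<^esub>"
      using f by auto
  qed
qed

end

section \<open>Slopes near infinity under automorphisms\<close>

lemma affine_above_or_below:
  fixes p a :: real
  shows "(\<forall>\<^sub>F t in at_top. p * t + a > t) \<or> (\<forall>\<^sub>F t in at_top. p * t + a \<le> t)"
proof -
  consider "p > 1" | "p = 1" | "p < 1" by linarith
  then show ?thesis
  proof cases
    case 1
    have "p * t + a > t" if "t > - a / (p - 1)" for t using that 1 by (simp add: field_simps)
    then show ?thesis by (auto simp: eventually_at_top_dense)
  next
    case 2 then show ?thesis by (cases "a > 0") auto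
  next
    case 3
    have "p * t + a \<le> t" if "t > a / (1 - p)" for t using that 3 by (simp add: field_simps)
    then show ?thesis by (auto simp: eventually_at_top_dense)
  qed
qed

text \<open>Positive real numbers are determined by the rational numbers below them.\<close>

lemma real_eq_of_multiples:
  fixes s s' :: real
  assumes "s > 0" "s' > 0" and iff: "\<And>n m :: nat. real n * s > real m \<longleftrightarrow> real n * s' > real m"
  shows "s = s'"
proof -
  have no: "\<not> x < y" if "x > 0" and xy: "\<And>n m :: nat. real n * x > real m \<longleftrightarrow> real n * y > real m" for x y :: real
  proof
    assume "x < y"
    then obtain n :: nat where n: "real n * y - real n * x > 1"
      using reals_Archimedean3[of "y - x"] by (auto simp: right_diff_distrib)
    define m where "m = nat \<lceil>real n * x\<rceil>"
    have "real m = of_int \<lceil>real n * x\<rceil>" using \<open>x > 0\<close> by (simp add: m_def)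
    then have "real m \<ge> real n * x" "real m < real n * x + 1" by linarith+
    then have "real n * y > real m" "\<not> real n * x > real m" using n by linarith+
    then show False using xy by blast
  qed
  show ?thesis using no[of s s'] no[of s' s] assms by force
qed

lemma affine_map_comp: "affine_map p a \<circ> affine_map q b = affine_map (p * q) (p * b + a)"
  by (auto simp: affine_map_def algebra_simps)

lemma affine_map_bij: "p \<noteq> 0 \<Longrightarrow> bij (affine_map p a)"
  by (rule bij_betw_byWitness[where f' = "\<lambda>t. (t - a) / p"]) (auto simp: affine_map_def)

context PL_halfline_group
begin

text \<open>Suppose that \<open>g\<close> does not move points to the right near infinity. Then it does not move them to
  the right anywhere beyond some \<open>N'\<close>, and the conjugates of \<open>k\<close> by powers of \<open>g\<close> have no fixed
  points beyond one common bound \<open>M\<close>; all hulls share the elements supported beyond \<open>M\<close>.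

  Conversely, suppose that \<open>g\<close> moves points beyond \<open>M\<close> to the right. A conjugate of the given
  commutator fixes everything up to a point \<open>q d > M\<close>, so its conjugate by \<open>g ^^ n\<close> fixes
  everything up to \<open>(g ^^ n) (q d)\<close>, which tends to infinity.\<close>

lemma sweeps_up_iff:
  assumes nonab: "u0 \<in> G" "v0 \<in> G" "affine_at_top (commutator H u0 v0) 1 \<tau>0" "\<tau>0 \<noteq> 0"
    and g: "g \<in> G"
  shows "sweeps_up H g \<longleftrightarrow> (\<forall>\<^sub>F t in at_top. g t > t)"
proof
  assume "sweeps_up H g"
  then obtain u v where uv: "u \<in> G" "v \<in> G" and pers: "persistent H (commutator H u v)"
    and trivial: "\<And>f. f \<in> G \<Longrightarrow> (\<And>n::nat. f \<in> support_hull H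
        (conjugate H (g ^^ n) (commutator H u v))) \<Longrightarrow> f = id"
    unfolding sweeps_up_def using g by auto
  let ?k = "commutator H u v"
  have k: "?k \<in> G" using commutator_G uv by blast
  obtain \<tau> where \<tau>: "affine_at_top ?k 1 \<tau>" using commutator_affine_at_top uv by blast
  have "\<tau> \<noteq> 0" using persistent_commutator_iff[OF uv \<tau>] pers by blast
  obtain N where N: "\<And>t. t > N \<Longrightarrow> ?k t = t + \<tau>"
    using \<tau> by (auto simp: affine_at_top_def eventually_at_top_dense)
  show "\<forall>\<^sub>F t in at_top. g t > t"
  proof (rule ccontr)
    assume not_up: "\<not> ?thesis"
    obtain p a where pa: "affine_at_top g p a" using ex_affine_at_top[OF g] by blast
    then have ev: "\<forall>\<^sub>F t in at_top. g t = p * t + a" by (simp add: affine_at_top_def)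
    have "\<not> (\<forall>\<^sub>F t in at_top. p * t + a > t)"
    proof
      assume "\<forall>\<^sub>F t in at_top. p * t + a > t"
      with ev have "\<forall>\<^sub>F t in at_top. g t > t" by eventually_elim simp
      then show False using not_up by blast
    qed
    then have "\<forall>\<^sub>F t in at_top. p * t + a \<le> t" using affine_above_or_below by blast
    with ev have "\<forall>\<^sub>F t in at_top. g t \<le> t" by eventually_elim simp
    then obtain N' where N': "\<And>t. t > N' \<Longrightarrow> g t \<le> t" by (auto simp: eventually_at_top_dense)
    define M where "M = max N N'"
    have pull_back: "inv_into UNIV (g ^^ n) t \<ge> t" if "t > M" for n t
    proof -
      have "(g ^^ n) s \<le> max s M" for s
      proof (induction n)
        case (Suc n)
        \<comment> \<open>A point up to \<open>M\<close> cannot jump beyond \<open>M\<close>: its image would lie where \<open>g\<close> moves nothing to the right.\<close>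
        have "g x \<le> max x M" for x
        proof (cases "x > M")
          case True then show ?thesis using N'[of x] by (simp add: M_def)
        next
          case False
          show ?thesis
          proof (rule ccontr)
            assume "\<not> ?thesis"
            then have "M < g x" "x \<le> M" using False by auto
            then have "g (g x) \<le> g x" using N'[of "g x"] by (simp add: M_def)
            then have "g x \<le> x" using G_mono[OF g] by (simp add: strict_mono_less_eq)
            then show False using \<open>M < g x\<close> \<open>x \<le> M\<close> by simp
          qed
        qed
        from this[of "(g ^^ n) s"] Suc show ?case by simp
      qed simp
      from this[of "inv_into UNIV (g ^^ n) t"] show ?thesis using that G_funpow[OF g] by simp
    qed
    obtain f where f: "f \<in> G" "f \<noteq> id" and fM: "\<And>t. t \<le> M \<Longrightarrow> f t = t"
      using ex_nontrivial_beyond[of M] by metis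
    have "f \<in> support_hull H (conjugate H (g ^^ n) ?k)" for n
    proof -
      let ?q = "g ^^ n"
      have q: "?q \<in> G" using G_funpow g by blast
      obtain r c where r: "affine_at_top ?q r c" using ex_affine_at_top[OF q] by blast
      then have "r * \<tau> \<noteq> 0" using \<open>\<tau> \<noteq> 0\<close> by (simp add: affine_at_top_def)
      moreover have "conjugate H ?q ?k t \<noteq> t" if "t > M" for t
      proof -
        have "inv_into UNIV ?q t > N" using pull_back[OF that, of n] that by (simp add: M_def)
        then show ?thesis using N \<open>\<tau> \<noteq> 0\<close> conjugate_fixes_iff[OF q k] by simp
      qed
      ultimately show ?thesis
        using in_hull_of_translation[OF conjugate_G[OF q k] conjugate_affine_at_top[OF q k r \<tau>] _ _ f(1) fM] by blast
    qed
    then show False using trivial f by blast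
  qed
next
  assume "\<forall>\<^sub>F t in at_top. g t > t"
  then obtain M where M: "\<And>t. t > M \<Longrightarrow> g t > t" by (auto simp: eventually_at_top_dense)
  let ?c = "commutator H u0 v0"
  have k0: "?c \<in> G" using commutator_G nonab by blast
  obtain d where d: "d > 0" "\<And>t. t \<le> d \<Longrightarrow> ?c t = t" using commutator_fixes_near_zero[OF nonab(1,2)] by metis
  obtain q where q: "q \<in> G" "q d > max M 0" using push_right[OF d(1)] by blast
  define u v where "u = conjugate H q u0" and "v = conjugate H q v0"
  have uv: "u \<in> G" "v \<in> G" using conjugate_G q nonab by (auto simp: u_def v_def)
  let ?k = "commutator H u v"
  have k_eq: "?k = conjugate H q ?c"
    unfolding u_def v_def using H.commutator_conjugate q(1) nonab(1,2) by simp
  have k: "?k \<in> G" using commutator_G uv by blast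
  obtain p a where pa: "affine_at_top q p a" using ex_affine_at_top[OF q(1)] by blast
  have "affine_at_top ?k 1 (p * \<tau>0)" using conjugate_affine_at_top[OF q(1) k0 pa nonab(3)] k_eq by simp
  moreover have "p * \<tau>0 \<noteq> 0" using pa nonab(4) by (simp add: affine_at_top_def)
  ultimately have "persistent H ?k" using persistent_commutator_iff uv by blast
  moreover have "f = id" if f: "f \<in> G"
    "\<And>n. f \<in> support_hull H (conjugate H (g ^^ n) ?k)" for f
  proof
    fix t
    have "M < q d" using q(2) by simp
    then obtain n where n: "(g ^^ n) (q d) > max t 0"
      using iterates_unbounded[OF G_cont[OF g] M] by blast
    let ?h = "g ^^ n"
    have h: "?h \<in> G" using G_funpow g by blast
    have "conjugate H ?h ?k s = s" if "s < ?h (q d)" for s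
    proof -
      have "?h (inv_into UNIV ?h s) < ?h (q d)" using that h by simp
      then have "inv_into UNIV ?h s < q d" using G_mono[OF h] by (simp only: strict_mono_less)
      then have "q (inv_into UNIV q (inv_into UNIV ?h s)) < q d" using q(1) by simp
      then have "inv_into UNIV q (inv_into UNIV ?h s) < d" using G_mono[OF q(1)] by (simp only: strict_mono_less)
      then have "?k (inv_into UNIV ?h s) = inv_into UNIV ?h s"
        unfolding k_eq using conjugate_fixes_iff[OF q(1) k0] d(2) by simp
      then show ?thesis using conjugate_fixes_iff[OF h k] by simp
    qed
    then show "f t = id t"
      using hull_fixes[OF conjugate_G[OF h k] _ f(2), of 0 "?h (q d)" t] n fixes_nonpos[OF f(1), of t]
      by (cases "t \<le> 0") auto
  qed
  ultimately show "sweeps_up H g"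
    unfolding sweeps_up_def using uv g by auto
qed

lemma rho_hom: "rho \<in> hom H (BijGroup UNIV)"
proof (rule homI)
  show "rho g \<in> carrier (BijGroup UNIV)" if g: "g \<in> carrier H" for g
  proof -
    obtain p a where "affine_at_top g p a" using ex_affine_at_top g by (metis carrier_H)
    then show ?thesis by (auto simp: rho_eq affine_at_top_def BijGroup_def Bij_def affine_map_bij)
  qed
  show "rho (f \<otimes>\<^bsub>H\<^esub> g) = rho f \<otimes>\<^bsub>BijGroup UNIV\<^esub> rho g"
    if fg: "f \<in> carrier H" "g \<in> carrier H" for f g
  proof -
    obtain p a q b where f: "affine_at_top f p a" and g: "affine_at_top g q b"
      using ex_affine_at_top fg by (metis carrier_H)
    then have "p \<noteq> 0" "q \<noteq> 0" by (auto simp: affine_at_top_def)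
    then have "affine_map p a \<otimes>\<^bsub>BijGroup UNIV\<^esub> affine_map q b = affine_map p a \<circ> affine_map q b"
      by (auto simp: BijGroup_def Bij_def affine_map_bij compose_def)
    then show ?thesis
      using fg rho_eq[OF affine_at_top_comp[OF f g]] by (simp add: rho_eq[OF f] rho_eq[OF g] affine_map_comp)
  qed
qed

text \<open>If all commutators were the identity near infinity, any two elements would have commuting germs
  there. To conclude that the image of \<^const>\<open>rho\<close> is then an abelian group, it must first be known to be
  a group, which holds since \<^const>\<open>rho\<close> is a homomorphism.\<close>

lemma ex_translating_commutator:
  assumes "\<not> comm_group ((Aff A P)\<lparr>carrier := rho ` G\<rparr>)"
  obtains u v \<tau> where "u \<in> G" "v \<in> G" "affine_at_top (commutator H u v) 1 \<tau>" "\<tau> \<noteq> 0"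
proof -
  let ?Q = "(BijGroup UNIV)\<lparr>carrier := rho ` G\<rparr>"
  interpret rho: group_hom "map_group G" "BijGroup UNIV" rho
    using rho_hom by (simp add: group_hom_def group_hom_axioms_def group_BijGroup H.group_axioms)
  have Q: "group ?Q"
    using group.subgroup_imp_group[OF group_BijGroup rho.img_is_subgroup] by simp
  have "\<not> comm_group ?Q" using assms by (simp add: Aff_def map_group_def)
  then obtain u v where uv: "u \<in> G" "v \<in> G" "rho u \<otimes>\<^bsub>BijGroup UNIV\<^esub> rho v \<noteq> rho v \<otimes>\<^bsub>BijGroup UNIV\<^esub> rho u"
    using group.group_comm_groupI[OF Q] by auto
  then have ne: "rho (u \<circ> v) \<noteq> rho (v \<circ> u)"
    using rho.hom_mult[of u v] rho.hom_mult[of v u] by simp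
  let ?c = "commutator H u v"
  obtain \<tau> where \<tau>: "affine_at_top ?c 1 \<tau>" using commutator_affine_at_top uv(1,2) by blast
  have eq: "?c \<circ> (v \<circ> u) = u \<circ> v" using uv by (simp add: commutator_H fun_eq_iff)
  have "\<tau> \<noteq> 0"
  proof
    assume "\<tau> = 0"
    obtain p a where pa: "affine_at_top (v \<circ> u) p a" using ex_affine_at_top[OF G_comp[OF uv(2,1)]] by blast
    have "affine_at_top (u \<circ> v) p a"
      using affine_at_top_comp[OF \<tau> pa] \<open>\<tau> = 0\<close> by (simp add: eq)
    then show False using ne rho_eq pa by metis
  qed
  then show thesis using that uv \<tau> by blast
qed

lemma sigma_r_comp:
  assumes "f \<in> G" "g \<in> G" shows "sigma_r (f \<circ> g) = sigma_r f * sigma_r g"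
proof -
  obtain p a q b where f: "affine_at_top f p a" and g: "affine_at_top g q b"
    using ex_affine_at_top assms by metis
  show ?thesis using affine_at_top_comp[OF f g] f g by (simp add: sigma_r_eq)
qed

lemma sigma_r_mem: "g \<in> G \<Longrightarrow> sigma_r g \<in> P"
  using ex_affine_at_top sigma_r_eq by metis

lemma sigma_r_hom: "sigma_r \<in> hom H (pos_real_group\<lparr>carrier := P\<rparr>)"
  by (rule homI) (auto simp: sigma_r_mem sigma_r_comp pos_real_group_def)

lemma sigma_r_nontrivial:
  assumes "u \<in> G" "v \<in> G" "affine_at_top (commutator H u v) 1 \<tau>" "\<tau> \<noteq> 0"
  shows "\<exists>g\<in>G. sigma_r g \<noteq> 1"
proof (rule ccontr)
  assume "\<not> ?thesis"
  then obtain a b where ab: "affine_at_top u 1 a" "affine_at_top v 1 b"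
    using ex_affine_at_top sigma_r_eq assms(1,2) by metis
  have "affine_at_top (commutator H u v) 1 0"
    using affine_at_top_comp[OF affine_at_top_comp[OF affine_at_top_comp[OF ab]
      affine_at_top_inv_G[OF assms(1) ab(1)]] affine_at_top_inv_G[OF assms(2) ab(2)]]
    by (simp add: commutator_H assms(1,2))
  then show False using affine_at_top_unique(2) assms(3,4) by blast
qed

lemma affine_at_top_funpow:
  "affine_at_top g 1 \<tau> \<Longrightarrow> affine_at_top (g ^^ n) 1 (real n * \<tau>)"
proof (induction n)
  case 0 then show ?case by (simp add: affine_at_top_def)
next
  case (Suc n)
  show ?case using affine_at_top_comp[OF Suc.prems Suc.IH[OF Suc.prems]] by (simp add: algebra_simps comp_def)
qed

lemma commutator_swap:
  assumes "u \<in> G" "v \<in> G"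
  shows "commutator H v u = inv_into UNIV (commutator H u v)"
proof
  fix t
  have "commutator H u v (commutator H v u t) = t"
    using assms by (simp add: commutator_H)
  then show "commutator H v u t = inv_into UNIV (commutator H u v) t"
    using G_inv_left[OF commutator_G[OF assms]] by metis
qed

text \<open>Conjugation by \<open>q\<close> multiplies translation lengths by the slope \<open>s\<close> of \<open>q\<close>. The sign of the
  resulting translation compares \<open>s\<close> with the fraction \<open>m / n\<close>.\<close>

lemma comparison_affine:
  assumes g: "g \<in> G" "affine_at_top g 1 \<tau>" and q: "q \<in> G" "affine_at_top q s b"
  shows "affine_at_top (inv\<^bsub>H\<^esub> (g [^]\<^bsub>H\<^esub> m) \<otimes>\<^bsub>H\<^esub>
     conjugate H q (g [^]\<^bsub>H\<^esub> n)) 1 ((real n * s - real m) * \<tau>)"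
proof -
  have mem: "g ^^ m \<in> G" "g ^^ n \<in> G" using G_funpow g by blast+
  show ?thesis
    using affine_at_top_comp[OF affine_at_top_inv_G[OF mem(1) affine_at_top_funpow[OF g(2)]]
      conjugate_affine_at_top[OF q(1) mem(2) q(2) affine_at_top_funpow[OF g(2)]]] mem g(1) q(1)
    by (simp add: G_inv conjugate_G algebra_simps)
qed

lemma translation_upward_iff: "affine_at_top g 1 \<tau> \<Longrightarrow> (\<forall>\<^sub>F t in at_top. g t > t) \<longleftrightarrow> \<tau> > 0"
proof -
  assume "affine_at_top g 1 \<tau>"
  then have ev: "\<forall>\<^sub>F t in at_top. g t = t + \<tau>" by (simp add: affine_at_top_def)
  have "(\<forall>\<^sub>F t in at_top. g t > t) \<longleftrightarrow> (\<forall>\<^sub>F t::real in at_top. t + \<tau> > t)"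
    by (rule eventually_cong) (use ev in \<open>auto elim: eventually_mono\<close>)
  then show ?thesis by simp
qed

text \<open>The comparison elements built from \<open>q\<close> and \<open>g\<close> are mapped by \<open>\<alpha>\<close> to those built from \<open>\<alpha> q\<close> and
  \<open>\<alpha> g\<close>. The latter are again translations near infinity because \<open>\<alpha> g\<close> is a commutator, and its
  translation length is positive because sweeping up is preserved.\<close>

lemma sigma_r_invariant:
  assumes nonab: "u \<in> G" "v \<in> G" "affine_at_top (commutator H u v) 1 \<tau>" "\<tau> > 0"
    and \<alpha>: "\<alpha> \<in> auto H" and q: "q \<in> G"
  shows "sigma_r (\<alpha> q) = sigma_r q"
proof -
  have iso: "\<alpha> \<in> iso H H" using \<alpha> by (auto simp: auto_def iso_def Bij_def)
  interpret group_hom "map_group G" "map_group G" \<alpha>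
    using iso by (simp add: group_hom_def group_hom_axioms_def H.group_axioms iso_def)
  note upward = sweeps_up_iff[OF nonab(1,2,3) less_imp_neq[OF nonab(4), symmetric]]
  have \<alpha>_mem: "\<alpha> x \<in> G" if "x \<in> G" for x using hom_closed that by simp
  have inv: "(\<forall>\<^sub>F t in at_top. \<alpha> x t > t) \<longleftrightarrow> (\<forall>\<^sub>F t in at_top. x t > t)" if "x \<in> G" for x
    using sweeps_up_iso[OF H.group_axioms H.group_axioms iso, of x] upward that \<alpha>_mem by simp
  define g where "g = commutator H u v"
  have g: "g \<in> G" using commutator_G nonab by (simp add: g_def)
  have g_up: "affine_at_top g 1 \<tau>" using nonab by (simp add: g_def)
  have \<alpha>g: "\<alpha> g = commutator H (\<alpha> u) (\<alpha> v)" using hom_commutator nonab by (simp add: g_def)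
  obtain \<tau>' where \<tau>': "affine_at_top (\<alpha> g) 1 \<tau>'"
    unfolding \<alpha>g using commutator_affine_at_top \<alpha>_mem nonab by blast
  have "\<tau>' > 0" using inv[OF g] translation_upward_iff g_up \<tau>' nonab(4) by blast
  obtain s b s' b' where s: "affine_at_top q s b" and s': "affine_at_top (\<alpha> q) s' b'"
    using ex_affine_at_top q \<alpha>_mem by metis
  have "real n * s > real m \<longleftrightarrow> real n * s' > real m" for n m
  proof -
    let ?x = "inv\<^bsub>H\<^esub> (g [^]\<^bsub>H\<^esub> m) \<otimes>\<^bsub>H\<^esub>
        conjugate H q (g [^]\<^bsub>H\<^esub> n)"
    have closed: "g [^]\<^bsub>H\<^esub> k \<in> carrier H" for k :: nat
      using H.nat_pow_closed g by simp
    have carriers: "q \<in> carrier H" "g \<in> carrier H" using q g by simp_all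
    have "?x \<in> carrier H"
      using H.m_closed H.inv_closed H.conjugate_closed closed q by (metis carrier_H)
    then have xG: "?x \<in> G" by simp
    have "\<alpha> ?x = inv\<^bsub>H\<^esub> ((\<alpha> g) [^]\<^bsub>H\<^esub> m) \<otimes>\<^bsub>H\<^esub>
        conjugate H (\<alpha> q) ((\<alpha> g) [^]\<^bsub>H\<^esub> n)"
      using closed carriers
      by (simp only: hom_mult hom_inv hom_conjugate hom_nat_pow H.inv_closed H.conjugate_closed)
    then have "affine_at_top (\<alpha> ?x) 1 ((real n * s' - real m) * \<tau>')"
      using comparison_affine[OF \<alpha>_mem[OF g] \<tau>' \<alpha>_mem[OF q] s'] by metis
    then have "(real n * s' - real m) * \<tau>' > 0 \<longleftrightarrow> (real n * s - real m) * \<tau> > 0"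
      using inv[OF xG] translation_upward_iff comparison_affine[OF g g_up q s] by blast
    then show ?thesis using \<open>\<tau>' > 0\<close> nonab(4) by (simp add: zero_less_mult_iff)
  qed
  then have "s = s'" using real_eq_of_multiples s s' by (simp add: affine_at_top_def)
  then show ?thesis using sigma_r_eq s s' by metis
qed

end

theorem theorem4p4:
  fixes A P :: "real set" and G :: "(real \<Rightarrow> real) set"
  assumes "subgroup P pos_real_group" and "P \<noteq> {1}"
    and "subgroup A add_real_group" and "A \<noteq> {0}"
    and "\<And>p a. p \<in> P \<Longrightarrow> a \<in> A \<Longrightarrow> p * a \<in> A"
    and "subgroup G (map_group (PLG {0..} A P))"
    and "PLB_halfline A P \<subseteq> G"
    and "\<not> comm_group ((Aff A P)\<lparr>carrier := rho ` G\<rparr>)"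
  shows "sigma_r \<in> hom (map_group G) (pos_real_group\<lparr>carrier := P\<rparr>) \<and>
         \<not> trivial_homomorphism (map_group G) (pos_real_group\<lparr>carrier := P\<rparr>) sigma_r \<and>
         (\<forall>\<alpha> \<in> auto (map_group G). \<forall>g \<in> G. sigma_r (\<alpha> g) = sigma_r g)"
proof -
  interpret PL_halfline_group A P G
    by (intro PL_halfline_group.intro PL_data.intro PL_halfline_group_axioms.intro) (fact assms)+
  obtain u v \<tau> where uv: "u \<in> G" "v \<in> G" and \<tau>: "affine_at_top (commutator (map_group G) u v) 1 \<tau>" "\<tau> \<noteq> 0"
    using ex_translating_commutator[OF assms(8)] by metis
  \<comment> \<open>Exchanging \<open>u\<close> and \<open>v\<close> inverts the commutator, so its translation length may be taken positive.\<close>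
  have "\<exists>u\<in>G. \<exists>v\<in>G. \<exists>\<tau>>0. affine_at_top (commutator (map_group G) u v) 1 \<tau>"
  proof (cases "\<tau> > 0")
    case True
    then show ?thesis using uv \<tau> by blast
  next
    case False
    have "affine_at_top (commutator (map_group G) v u) 1 (- \<tau>)"
      using affine_at_top_inv_G[OF commutator_G[OF uv] \<tau>(1)] commutator_swap[OF uv] by simp
    then show ?thesis using False uv \<tau>(2) by (metis linorder_neqE_linordered_idom neg_0_less_iff_less)
  qed
  moreover have "\<not> trivial_homomorphism (map_group G) (pos_real_group\<lparr>carrier := P\<rparr>) sigma_r"
    using sigma_r_nontrivial[OF uv \<tau>] by (auto simp: trivial_homomorphism_def pos_real_group_def)
  ultimately show ?thesis using sigma_r_hom sigma_r_invariant by blast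
qed

end
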